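(* Let $\Lambda=\{\lambda_1,\lambda_2,\ldots\}$ be a countable set of distinct real numbers which has an integral basis, let $-\infty\le\alpha<\beta\le\infty$, and let $f_1,f_2\in\mathcal{D}_{\Lambda}$ be two equivalent almost periodic functions ($f_1\sim f_2$) in the vertical strip $\{\sigma+it\in\mathbb{C}:\alpha<\sigma<\beta\}$. Let $E$ be an open set of real numbers included in $(\alpha,\beta)$. Then $$\bigcup_{\sigma\in E}\operatorname{Img}\left(f_1(\sigma+it)\right)=\bigcup_{\sigma\in E}\operatorname{Img}\left(f_2(\sigma+it)\right),$$ where $\operatorname{Img}(f(\sigma+it)):=\{f(\sigma+it):t\in\mathbb{R}\}$. That is, $f_1$ and $f_2$ take the same set of values on the region $\{s=\sigma+it\in\mathbb{C}:\sigma\in E\}$.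
   Context: Almost periodic functions. Let $U=\{s\in\mathbb{C}:\alpha<\operatorname{Re}s<\beta\}$ with $-\infty\le\alpha<\beta\le\infty$. $AP(U,\mathbb{C})$ is the set of functions $f:U\to\mathbb{C}$ which can be approximated uniformly on every reduced strip $\{\alpha_1\le\operatorname{Re}s\le\beta_1\}$, $\alpha<\alpha_1<\beta_1<\beta$, by exponential polynomials $a_1e^{\lambda_1s}+\cdots+a_ne^{\lambda_ns}$ with $a_j\in\mathbb{C}$ and $\lambda_j\in\mathbb{R}$. The Dirichlet series of $f\in AP(U,\mathbb{C})$ is the formal exponential sum $\sum_{\lambda}a(\lambda)e^{\lambda s}$ with $a(\lambda)=\lim_{T\to\infty}\frac{1}{2T}\int_{-T}^{T}f(\sigma+it)e^{-\lambda(\sigma+it)}\,dt$, which does not depend on $\sigma\in(\alpha,\beta)$ and is nonzero for at most countably many real $\lambda$; it determines $f$. The class $\mathcal{D}_\Lambda$. For a countable set $\Lambda=\{\lambda_1,\lambda_2,\ldots\}$ of distinct real numbers, $\mathcal{D}_\Lambda$ consists of the functions $f\in AP(U,\mathbb{C})$ (for such a strip $U$) whose Dirichlet series is of the form $\sum_{j\ge1}a_je^{\lambda_js}$, $a_j\in\mathbb{C}$, $\lambda_j\in\Lambda$. Integral basis. An integral basis for $\Lambda$ is a basis $G_\Lambda=\{g_1,g_2,\ldots\}$ of the $\mathbb{Q}$-vector space $V\subset\mathbb{R}$ generated by $\Lambda$ such that every $\lambda_j$ is a finite linear combination of the $g_k$ with integer coefficients. Equivalence. Two functions in $\mathcal{D}_\Lambda$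 with Dirichlet series $\sum_{j\ge1}a_je^{\lambda_js}$ and $\sum_{j\ge1}b_je^{\lambda_js}$ are equivalent (written $\sim$) if there is a $\mathbb{Q}$-linear map $\psi:V\to\mathbb{R}$ such that $b_j=a_je^{i\psi(\lambda_j)}$ for all $j\ge1$. *)

theory Defs
  imports "HOL-Analysis.Analysis"
begin

definition rat_scale :: "rat \<Rightarrow> real \<Rightarrow> real" where
  "rat_scale q x = of_rat q * x"

global_interpretation rat_vs: vector_space rat_scale
  by unfold_locales (simp_all add: rat_scale_def algebra_simps of_rat_add of_rat_mult)

definition rat_linear_on :: "real set \<Rightarrow> (real \<Rightarrow> real) \<Rightarrow> bool" where
  "rat_linear_on V \<psi> \<longleftrightarrow>
     (\<forall>x\<in>V. \<forall>y\<in>V. \<psi> (x + y) = \<psi> x + \<psi> y) \<and>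
     (\<forall>q. \<forall>x\<in>V. \<psi> (rat_scale q x) = rat_scale q (\<psi> x))"

definition integral_basis :: "real set \<Rightarrow> real set \<Rightarrow> bool" where
  "integral_basis \<Lambda> G \<longleftrightarrow>
     rat_vs.independent G \<and> rat_vs.span G = rat_vs.span \<Lambda> \<and>
     (\<forall>\<mu>\<in>\<Lambda>. \<exists>F (c :: real \<Rightarrow> int).
        finite F \<and> F \<subseteq> G \<and> \<mu> = (\<Sum>g\<in>F. of_int (c g) * g))"

definition exponential_polynomial :: "(complex \<Rightarrow> complex) \<Rightarrow> bool" where
  "exponential_polynomial P \<longleftrightarrow>
     (\<exists>(n :: nat) (a :: nat \<Rightarrow> complex) (l :: nat \<Rightarrow> real).
        \<forall>s. P s = (\<Sum>j<n. a j * exp (of_real (l j) * s)))"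

text \<open>A function on a strip is represented by a total function; only its values on
  the strip \<open>\<alpha> < Re s < \<beta>\<close> matter in the following notions.\<close>

definition almost_periodic :: "ereal \<Rightarrow> ereal \<Rightarrow> (complex \<Rightarrow> complex) set" where
  "almost_periodic \<alpha> \<beta> =
     {f. \<forall>\<alpha>\<^sub>1 \<beta>\<^sub>1 :: real. \<alpha> < ereal \<alpha>\<^sub>1 \<longrightarrow> \<alpha>\<^sub>1 < \<beta>\<^sub>1 \<longrightarrow> ereal \<beta>\<^sub>1 < \<beta> \<longrightarrow>
        (\<forall>\<epsilon>>0. \<exists>P. exponential_polynomial P \<and>
           (\<forall>s. \<alpha>\<^sub>1 \<le> Re s \<and> Re s \<le> \<beta>\<^sub>1 \<longrightarrow> cmod (f s - P s) < \<epsilon>))}"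

text \<open>The coefficient of \<open>exp (\<mu> * s)\<close> is the common value, over all abscissae \<open>\<sigma>\<close> of the strip, of
  the mean values below; for almost periodic \<open>f\<close> these limits exist and do not depend on
  \<open>\<sigma>\<close>.\<close>

definition dirichlet_coeff ::
  "ereal \<Rightarrow> ereal \<Rightarrow> (complex \<Rightarrow> complex) \<Rightarrow> real \<Rightarrow> complex" where
  "dirichlet_coeff \<alpha> \<beta> f \<mu> =
     (THE c. \<forall>\<sigma> :: real. \<alpha> < ereal \<sigma> \<and> ereal \<sigma> < \<beta> \<longrightarrow>
        ((\<lambda>T :: real. of_real (1 / (2 * T)) *
            integral {-T..T} (\<lambda>t. f (Complex \<sigma> t) * exp (- of_real \<mu> * Complex \<sigma> t)))
          \<longlongrightarrow> c) at_top)"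

definition D_class :: "ereal \<Rightarrow> ereal \<Rightarrow> real set \<Rightarrow> (complex \<Rightarrow> complex) set" where
  "D_class \<alpha> \<beta> \<Lambda> =
     {f \<in> almost_periodic \<alpha> \<beta>. \<forall>\<mu>. dirichlet_coeff \<alpha> \<beta> f \<mu> \<noteq> 0 \<longrightarrow> \<mu> \<in> \<Lambda>}"

definition ap_equivalent ::
  "ereal \<Rightarrow> ereal \<Rightarrow> real set \<Rightarrow> (complex \<Rightarrow> complex) \<Rightarrow> (complex \<Rightarrow> complex) \<Rightarrow> bool" where
  "ap_equivalent \<alpha> \<beta> \<Lambda> f\<^sub>1 f\<^sub>2 \<longleftrightarrow>
     (\<exists>\<psi>. rat_linear_on (rat_vs.span \<Lambda>) \<psi> \<and>
        (\<forall>\<mu>\<in>\<Lambda>. dirichlet_coeff \<alpha> \<beta> f\<^sub>2 \<mu> =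
           dirichlet_coeff \<alpha> \<beta> f\<^sub>1 \<mu> * exp (\<i> * of_real (\<psi> \<mu>))))"

definition line_image :: "(complex \<Rightarrow> complex) \<Rightarrow> real \<Rightarrow> complex set" where
  "line_image f \<sigma> = {f (Complex \<sigma> t) | t. t \<in> (UNIV :: real set)}"

end

(* Kronecker's theorem for the integral basis yields translates of f1 whose Dirichlet coefficients
   converge to those of f2. By a diagonal argument over the frequencies of approximating exponential
   polynomials, a subsequence of these translates converges uniformly on a reduced strip, and the
   uniqueness theorem for almost periodic functions identifies the limit as f2. By Hurwitz's theorem
   every value of f2 is then taken by f1 in the same strip, unless f2 is constant there; in that case
   f1, being a limit of translates of f2, is the same constant. The relation is symmetric. *)

theory Submission
  imports Defs "HOL-Complex_Analysis.Great_Picard"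
begin

section \<open>Mean values on the real line\<close>

text \<open>Convergence of Dirichlet coefficients does not by itself make translates of
  \<open>f\<^sub>1\<close> approach \<open>f\<^sub>2\<close>: the series need not converge, and the
  approximating exponential polynomials may contain frequencies outside \<Lambda>, about which
  Kronecker's theorem says nothing. Hence a limit is produced by compactness before anything is
  known about it. The integral basis matters because exp (i \<mu> t) is then a product of integer
  powers of the exp (i g t); with rational exponents, the values at the basis elements would fix exp
  (i \<psi>(\<mu>)) only up to a root of unity. The mean values serve two ends: reading off the
  coefficients of a uniform limit, and proving uniqueness on one vertical line at a time through the
  mean of the squared modulus.\<close>

definition avg :: "real \<Rightarrow> (real \<Rightarrow> complex) \<Rightarrow> complex" where
  "avg T g = of_real (1 / (2 * T)) * integral {-T..T} g"

text \<open>A relation rather than a limit operator, so that each rule below yields the existence of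
  the mean together with its value.\<close>

definition has_mean :: "(real \<Rightarrow> complex) \<Rightarrow> complex \<Rightarrow> bool" where
  "has_mean g m \<longleftrightarrow> ((\<lambda>T. avg T g) \<longlongrightarrow> m) at_top"

lemma has_mean_unique: "has_mean g m \<Longrightarrow> has_mean g m' \<Longrightarrow> m = m'"
  unfolding has_mean_def by (rule tendsto_unique[rotated]) auto

lemma integrable_Icc:
  fixes g :: "real \<Rightarrow> complex"
  assumes "continuous_on UNIV g"
  shows "g integrable_on {a..b}"
  by (meson assms continuous_on_subset integrable_continuous_interval subset_UNIV)

lemma avg_add:
  assumes "continuous_on UNIV u" "continuous_on UNIV v"
  shows "avg T (\<lambda>t. u t + v t) = avg T u + avg T v"
  by (simp add: avg_def integral_add integrable_Icc assms distrib_left)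

lemma avg_cmult: "avg T (\<lambda>t. c * u t) = c * avg T u"
  by (simp add: avg_def)

lemma avg_norm_le:
  assumes "continuous_on UNIV u" "\<And>t. cmod (u t) \<le> B" "T > 0"
  shows "cmod (avg T u) \<le> B"
proof -
  have "cmod (integral {-T..T} u) \<le> B * (T - (-T))"
    by (rule integral_bound) (use assms in \<open>auto intro: continuous_on_subset\<close>)
  hence "cmod (avg T u) \<le> \<bar>1 / (2 * T)\<bar> * (B * (T - (-T)))"
    unfolding avg_def norm_mult norm_of_real by (rule mult_left_mono) simp
  also have "\<dots> = B" using \<open>T > 0\<close> by (simp add: field_simps)
  finally show ?thesis .
qed

text \<open>The bound is uniform in \<open>T\<close>; this uniformity permits the interchange of
  limits in \<open>has_mean_uniform_limit\<close>.\<close>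

lemma avg_dist_le:
  assumes "continuous_on UNIV u" "continuous_on UNIV v" "\<And>t. dist (u t) (v t) \<le> B" "T > 0"
  shows "dist (avg T u) (avg T v) \<le> B"
proof -
  have "avg T u = avg T (\<lambda>t. (u t - v t) + v t)" by simp
  also have "\<dots> = avg T (\<lambda>t. u t - v t) + avg T v"
    by (rule avg_add) (intro continuous_intros assms)+
  finally have "dist (avg T u) (avg T v) = cmod (avg T (\<lambda>t. u t - v t))"
    by (simp add: dist_norm)
  also have "\<dots> \<le> B"
    by (rule avg_norm_le) (use assms in \<open>auto intro!: continuous_intros simp: dist_norm\<close>)
  finally show ?thesis .
qed

lemma has_mean_0: "has_mean (\<lambda>t. 0) 0"
  by (simp add: has_mean_def avg_def)

lemma has_mean_add:
  assumes "continuous_on UNIV u" "continuous_on UNIV v" "has_mean u a" "has_mean v b"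
  shows "has_mean (\<lambda>t. u t + v t) (a + b)"
  using assms unfolding has_mean_def by (simp add: avg_add tendsto_add)

lemma has_mean_cmult: "has_mean u a \<Longrightarrow> has_mean (\<lambda>t. c * u t) (c * a)"
  unfolding has_mean_def by (simp add: avg_cmult tendsto_mult_left)

lemma has_mean_diff:
  assumes "continuous_on UNIV u" "continuous_on UNIV v" "has_mean u a" "has_mean v b"
  shows "has_mean (\<lambda>t. u t - v t) (a - b)"
  using has_mean_add[OF assms(1) _ assms(3) has_mean_cmult[OF assms(4), of "-1"]] assms(2)
  by (simp add: continuous_on_minus)

lemma has_mean_sum:
  assumes "finite F" "\<And>x. x \<in> F \<Longrightarrow> continuous_on UNIV (u x)" "\<And>x. x \<in> F \<Longrightarrow> has_mean (u x) (m x)"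
  shows "has_mean (\<lambda>t. \<Sum>x\<in>F. u x t) (\<Sum>x\<in>F. m x)"
  using assms
proof (induction F rule: finite_induct)
  case empty
  thus ?case by (simp add: has_mean_0)
next
  case (insert x F)
  show ?case unfolding sum.insert[OF insert(1,2)]
    by (rule has_mean_add) (use insert in \<open>auto intro!: continuous_on_sum\<close>)
qed

text \<open>Orthogonality of the characters. For \<mu> \<noteq> 0 the antiderivative is bounded, so
  the average is O(1/T).\<close>

lemma has_mean_exp: "has_mean (\<lambda>t. exp (\<i> * of_real \<mu> * of_real t)) (if \<mu> = 0 then 1 else 0)"
proof (cases "\<mu> = 0")
  case True
  have "eventually (\<lambda>T. avg T (\<lambda>t. 1) = 1) at_top"
    using eventually_gt_at_top[of 0] by eventually_elim (simp add: avg_def scaleR_conv_of_real)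
  thus ?thesis unfolding has_mean_def using True by (simp add: tendsto_eventually)
next
  case False
  let ?e = "\<lambda>t::real. exp (\<i> * of_real \<mu> * of_real t)"
  have b: "cmod (avg T ?e) \<le> (1 / \<bar>\<mu>\<bar>) / T" if "T > 0" for T
  proof -
    have "((\<lambda>t. exp (\<i> * of_real \<mu> * of_real t) / (\<i> * \<mu>)) has_vector_derivative ?e t) (at t within {-T..T})" for t
      by (rule has_vector_derivative_real_field[of "\<lambda>z. exp (\<i> * of_real \<mu> * z) / (\<i> * \<mu>)"])
        (use False in \<open>auto intro!: derivative_eq_intros\<close>)
    hence "(?e has_integral ?e T / (\<i> * \<mu>) - ?e (-T) / (\<i> * \<mu>)) {-T..T}"
      by (intro fundamental_theorem_of_calculus) (use that in auto)
    hence "integral {-T..T} ?e = (?e T - ?e (-T)) / (\<i> * \<mu>)"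
      by (simp add: integral_unique diff_divide_distrib)
    moreover have "cmod (?e T - ?e (-T)) \<le> 1 + 1"
      by (rule order_trans[OF norm_triangle_ineq4]) (simp add: norm_exp_eq_Re)
    ultimately have "cmod (integral {-T..T} ?e) \<le> 2 / \<bar>\<mu>\<bar>"
      by (simp add: norm_mult norm_divide divide_right_mono)
    hence "cmod (avg T ?e) \<le> \<bar>1 / (2 * T)\<bar> * (2 / \<bar>\<mu>\<bar>)"
      unfolding avg_def norm_mult norm_of_real by (rule mult_left_mono) simp
    also have "\<dots> = (1 / \<bar>\<mu>\<bar>) / T" using that by simp
    finally show ?thesis .
  qed
  have "((\<lambda>T. (1 / \<bar>\<mu>\<bar>) / T) \<longlongrightarrow> 0) at_top"
    by (intro tendsto_divide_0[OF tendsto_const] filterlim_at_top_imp_at_infinity filterlim_ident)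
  hence "((\<lambda>T. avg T ?e) \<longlongrightarrow> 0) at_top"
    by (rule Lim_null_comparison[rotated])
      (use eventually_gt_at_top[of 0] in eventually_elim, rule b)
  thus ?thesis using False by (simp add: has_mean_def)
qed

text \<open>Interchange of the limits in \<open>k\<close> and \<open>T\<close>. The averages of
  \<open>G k\<close> and \<open>g\<close> are close uniformly in \<open>T\<close>, which makes
  \<open>m\<close> a Cauchy sequence; its limit is then the mean of \<open>g\<close>.\<close>

lemma has_mean_uniform_limit:
  assumes ul: "uniform_limit UNIV G g sequentially"
    and cont: "\<And>k. continuous_on UNIV (G k)"
    and mean: "\<And>k. has_mean (G k) (m k)"
  obtains l where "m \<longlonglongrightarrow> l" "has_mean g l"
proof -
  have contg: "continuous_on UNIV g"
    by (rule uniform_limit_theorem[OF _ ul]) (use cont in auto)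
  have near: "\<exists>N. \<forall>k\<ge>N. \<forall>T>0. dist (avg T (G k)) (avg T g) \<le> e" if e: "e > 0" for e
  proof -
    obtain N where "\<And>k t. k \<ge> N \<Longrightarrow> dist (G k t) (g t) < e"
      using uniform_limitD[OF ul e] by (auto simp: eventually_sequentially)
    thus ?thesis
      by (intro exI[of _ N] allI impI avg_dist_le cont contg) (auto intro: less_imp_le)
  qed
  have mk: "((\<lambda>T. avg T (G k)) \<longlongrightarrow> m k) at_top" for k
    using mean by (simp add: has_mean_def)
  have "Cauchy m"
  proof (rule metric_CauchyI)
    fix e :: real assume "e > 0"
    then obtain N where N: "\<forall>k\<ge>N. \<forall>T>0. dist (avg T (G k)) (avg T g) \<le> e / 3"
      using near[of "e / 3"] by auto
    have "dist (m j) (m k) < e" if "j \<ge> N" "k \<ge> N" for j k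
    proof -
      have "((\<lambda>T. dist (avg T (G j)) (avg T (G k))) \<longlongrightarrow> dist (m j) (m k)) at_top"
        by (intro tendsto_dist mk)
      moreover have "eventually (\<lambda>T. dist (avg T (G j)) (avg T (G k)) \<le> e / 3 + e / 3) at_top"
        using eventually_gt_at_top[of 0]
      proof eventually_elim
        case (elim T)
        have "dist (avg T (G j)) (avg T (G k)) \<le> dist (avg T (G j)) (avg T g) + dist (avg T (G k)) (avg T g)"
          by (rule dist_triangle2)
        thus ?case using N that elim by (smt (verit))
      qed
      ultimately have "dist (m j) (m k) \<le> e / 3 + e / 3"
        by (rule tendsto_upperbound) auto
      thus ?thesis using \<open>e > 0\<close> by simp
    qed
    thus "\<exists>M. \<forall>j\<ge>M. \<forall>k\<ge>M. dist (m j) (m k) < e" by blast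
  qed
  then obtain l where l: "m \<longlonglongrightarrow> l"
    by (auto simp: Cauchy_convergent_iff convergent_def)
  have "has_mean g l"
    unfolding has_mean_def
  proof (rule tendstoI)
    fix e :: real assume "e > 0"
    obtain N where N: "\<forall>k\<ge>N. \<forall>T>0. dist (avg T (G k)) (avg T g) \<le> e / 3"
      using near[of "e / 3"] \<open>e > 0\<close> by auto
    obtain N' where N': "\<forall>k\<ge>N'. dist (m k) l < e / 3"
      using metric_LIMSEQ_D[OF l, of "e / 3"] \<open>e > 0\<close> by auto
    define k where "k = max N N'"
    have "eventually (\<lambda>T. dist (avg T (G k)) (m k) < e / 3) at_top"
      by (rule tendstoD[OF mk]) (use \<open>e > 0\<close> in simp)
    thus "eventually (\<lambda>T. dist (avg T g) l < e) at_top"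
      using eventually_gt_at_top[of 0]
    proof eventually_elim
      case (elim T)
      have "dist (avg T (G k)) (avg T g) \<le> e / 3" "dist (m k) l < e / 3"
        using N N' elim by (auto simp: k_def)
      thus ?case using elim
          dist_triangle[of "avg T g" l "avg T (G k)"] dist_triangle[of "avg T (G k)" l "m k"]
        by (simp add: dist_commute)
    qed
  qed
  with l show ?thesis by (rule that)
qed

text \<open>The windows [-T, T] and [-T + c, T + c] differ by two intervals of length
  \<open>\<bar>c\<bar>\<close>, whose integrals are bounded independently of \<open>T\<close> and
  disappear after division by 2T. The condition \<open>T > \<bar>c\<bar>\<close> makes the windows
  overlap.\<close>

lemma has_mean_shift:
  assumes cont: "continuous_on UNIV g" and bd: "\<And>t. cmod (g t) \<le> B" and m: "has_mean g m"
  shows "has_mean (\<lambda>t. g (t + c)) m"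
proof -
  have "dist (avg T (\<lambda>t. g (t + c))) (avg T g) \<le> (\<bar>c\<bar> * B) / T" if "T > \<bar>c\<bar>" for T
  proof -
    have split: "integral {x..z} g = integral {x..y} g + integral {y..z} g" if "x \<le> y" "y \<le> z" for x y z
      using that by (simp add: Henstock_Kurzweil_Integration.integral_combine integrable_Icc cont)
    have bd': "cmod (integral {x..y} g) \<le> B * (y - x)" if "x \<le> y" for x y
      by (rule integral_bound) (use that cont bd in \<open>auto intro: continuous_on_subset\<close>)
    have sh: "integral {-T..T} (\<lambda>t. g (t + c)) = integral {-T+c..T+c} g"
      using integral_shift_real_ivl[of "-T+c" c "T+c" g] by simp
    have "cmod (integral {-T..T} (\<lambda>t. g (t + c)) - integral {-T..T} g) \<le> 2 * (\<bar>c\<bar> * B)"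
    proof (cases "c \<ge> 0")
      case True
      have "integral {-T..T} (\<lambda>t. g (t + c)) - integral {-T..T} g
              = integral {T..T+c} g - integral {-T..-T+c} g"
        using split[of "-T+c" T "T+c"] split[of "-T" "-T+c" T] True that by (simp add: sh)
      also have "cmod \<dots> \<le> B * c + B * c"
        by (rule order_trans[OF norm_triangle_ineq4])
          (use bd'[of T "T+c"] bd'[of "-T" "-T+c"] True in auto)
      finally show ?thesis using True by (simp add: mult.commute)
    next
      case False
      have "integral {-T..T} (\<lambda>t. g (t + c)) - integral {-T..T} g
              = integral {-T+c..-T} g - integral {T+c..T} g"
        using split[of "-T+c" "-T" "T+c"] split[of "-T" "T+c" T] False that by (simp add: sh)
      also have "cmod \<dots> \<le> B * (-c) + B * (-c)"
        by (rule order_trans[OF norm_triangle_ineq4])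
          (use bd'[of "T+c" T] bd'[of "-T+c" "-T"] False in auto)
      finally show ?thesis using False by (simp add: mult.commute)
    qed
    moreover have "avg T (\<lambda>t. g (t + c)) - avg T g
        = of_real (1 / (2 * T)) * (integral {-T..T} (\<lambda>t. g (t + c)) - integral {-T..T} g)"
      by (simp add: avg_def algebra_simps)
    ultimately have "dist (avg T (\<lambda>t. g (t + c))) (avg T g) \<le> \<bar>1 / (2 * T)\<bar> * (2 * (\<bar>c\<bar> * B))"
      unfolding dist_norm by (simp only: norm_mult norm_of_real mult_left_mono abs_ge_zero)
    also have "\<dots> = (\<bar>c\<bar> * B) / T" using that by simp
    finally show ?thesis .
  qed
  hence "eventually (\<lambda>T. norm (avg T (\<lambda>t. g (t + c)) - avg T g) \<le> (\<bar>c\<bar> * B) / T) at_top"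
    by (intro eventually_mono[OF eventually_gt_at_top[of "\<bar>c\<bar>"]]) (simp add: dist_norm)
  moreover have "((\<lambda>T. (\<bar>c\<bar> * B) / T) \<longlongrightarrow> 0) at_top"
    by (intro tendsto_divide_0[OF tendsto_const] filterlim_at_top_imp_at_infinity filterlim_ident)
  ultimately have "((\<lambda>T. avg T (\<lambda>t. g (t + c)) - avg T g) \<longlongrightarrow> 0) at_top"
    by (rule Lim_null_comparison)
  from tendsto_add[OF this, of "\<lambda>T. avg T g" m] m show ?thesis
    by (simp add: has_mean_def)
qed

section \<open>Bohr almost periodic functions and uniqueness\<close>

lemma uniform_limit_mult_bounded:
  fixes f :: "'b \<Rightarrow> 'a \<Rightarrow> complex"
  assumes "uniform_limit S f l F" "\<And>x. x \<in> S \<Longrightarrow> cmod (h x) \<le> B"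
  shows "uniform_limit S (\<lambda>n x. h x * f n x) (\<lambda>x. h x * l x) F"
proof (rule uniform_limitI)
  fix e :: real assume "e > 0"
  \<comment> \<open>\<open>\<bar>B\<bar> + 1\<close> is positive whatever \<open>B\<close> is, so it
    can serve as a divisor.\<close>
  hence "e / (\<bar>B\<bar> + 1) > 0" by (simp add: add_nonneg_pos)
  from uniform_limitD[OF assms(1) this]
  show "\<forall>\<^sub>F n in F. \<forall>x\<in>S. dist (h x * f n x) (h x * l x) < e"
  proof eventually_elim
    case (elim n)
    show ?case
    proof
      fix x assume x: "x \<in> S"
      have "dist (h x * f n x) (h x * l x) = cmod (h x) * dist (f n x) (l x)"
        by (simp add: dist_norm norm_mult flip: right_diff_distrib)
      also have "\<dots> \<le> (\<bar>B\<bar> + 1) * dist (f n x) (l x)"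
        using assms(2)[OF x] by (intro mult_right_mono) auto
      also have "\<dots> < (\<bar>B\<bar> + 1) * (e / (\<bar>B\<bar> + 1))"
        using elim x by (intro mult_strict_left_mono) auto
      also have "\<dots> = e" by (simp add: add_nonneg_pos)
      finally show "dist (h x * f n x) (h x * l x) < e" .
    qed
  qed
qed

lemma has_mean_const: "has_mean (\<lambda>t. c) c"
  using has_mean_cmult[OF has_mean_exp[of 0], of c] by simp

lemma has_mean_norm_le:
  assumes "continuous_on UNIV u" "\<And>t. cmod (u t) \<le> B" "has_mean u m"
  shows "cmod m \<le> B"
proof (rule tendsto_upperbound)
  show "((\<lambda>T. cmod (avg T u)) \<longlongrightarrow> cmod m) at_top"
    using assms(3) unfolding has_mean_def by (rule tendsto_norm)
  show "eventually (\<lambda>T. cmod (avg T u) \<le> B) at_top"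
    using eventually_gt_at_top[of 0] by eventually_elim (use assms avg_norm_le in blast)
qed simp

section \<open>Uniform closure of the trigonometric polynomials\<close>

definition trig_poly :: "(real \<Rightarrow> complex) \<Rightarrow> bool" where
  "trig_poly P \<longleftrightarrow>
     (\<exists>F a. finite F \<and> P = (\<lambda>t. \<Sum>\<mu>\<in>F. a \<mu> * exp (\<i> * of_real \<mu> * of_real t)))"

text \<open>Bohr's class is introduced by approximation instead of relatively dense almost periods,
  because restricting the approximations in \<open>almost_periodic\<close> to a vertical line gives
  this form directly.\<close>

definition bohr_ap :: "(real \<Rightarrow> complex) \<Rightarrow> bool" where
  "bohr_ap g \<longleftrightarrow> (\<forall>\<epsilon>>0. \<exists>P. trig_poly P \<and> (\<forall>t. cmod (g t - P t) < \<epsilon>))"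

lemma trig_poly_diff:
  assumes "trig_poly P" "trig_poly Q"
  shows "trig_poly (\<lambda>t. P t - Q t)"
proof -
  obtain F a where F: "finite F" "P = (\<lambda>t. \<Sum>\<mu>\<in>F. a \<mu> * exp (\<i> * of_real \<mu> * of_real t))"
    using assms(1) by (auto simp: trig_poly_def)
  obtain G b where G: "finite G" "Q = (\<lambda>t. \<Sum>\<mu>\<in>G. b \<mu> * exp (\<i> * of_real \<mu> * of_real t))"
    using assms(2) by (auto simp: trig_poly_def)
  have "P t - Q t = (\<Sum>\<mu>\<in>F \<union> G. ((if \<mu> \<in> F then a \<mu> else 0) - (if \<mu> \<in> G then b \<mu> else 0))
          * exp (\<i> * of_real \<mu> * of_real t))" for t
  proof -
    have "P t = (\<Sum>\<mu>\<in>F \<union> G. (if \<mu> \<in> F then a \<mu> else 0) * exp (\<i> * of_real \<mu> * of_real t))"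
      unfolding F(2) by (rule sum.mono_neutral_cong_left) (use F G in auto)
    moreover have "Q t = (\<Sum>\<mu>\<in>F \<union> G. (if \<mu> \<in> G then b \<mu> else 0) * exp (\<i> * of_real \<mu> * of_real t))"
      unfolding G(2) by (rule sum.mono_neutral_cong_left) (use F G in auto)
    ultimately show ?thesis by (simp only: left_diff_distrib sum_subtractf)
  qed
  thus ?thesis unfolding trig_poly_def using F(1) G(1) by (intro exI[of _ "F \<union> G"] exI conjI) auto
qed

lemma trig_poly_continuous: "trig_poly P \<Longrightarrow> continuous_on UNIV P"
  unfolding trig_poly_def by (auto intro!: continuous_intros)

lemma trig_poly_bounded: assumes "trig_poly P" obtains B where "\<And>t. cmod (P t) \<le> B"
proof -
  obtain F a where F: "finite F" "P = (\<lambda>t. \<Sum>\<mu>\<in>F. a \<mu> * exp (\<i> * of_real \<mu> * of_real t))"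
    using assms by (auto simp: trig_poly_def)
  have "cmod (P t) \<le> (\<Sum>\<mu>\<in>F. cmod (a \<mu>))" for t
    unfolding F(2) by (rule sum_norm_le) (simp add: norm_mult norm_exp_eq_Re)
  thus ?thesis by (rule that)
qed

lemma trig_poly_imp_bohr_ap: "trig_poly P \<Longrightarrow> bohr_ap P"
  unfolding bohr_ap_def by (intro allI impI exI[of _ P]) simp

lemma bohr_ap_sequence:
  assumes "bohr_ap g"
  obtains P where "\<And>k. trig_poly (P k)" "uniform_limit UNIV P g sequentially"
proof -
  have "\<exists>P. trig_poly P \<and> (\<forall>t. cmod (g t - P t) < 1 / Suc k)" for k
    using assms unfolding bohr_ap_def by (meson divide_pos_pos of_nat_0_less_iff zero_less_Suc zero_less_one)
  then obtain P where P: "\<And>k. trig_poly (P k)" "\<And>k t. cmod (g t - P k t) < 1 / Suc k"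
    by metis
  have "uniform_limit UNIV P g sequentially"
  proof (rule uniform_limitI)
    fix e :: real assume "e > 0"
    then obtain N where N: "inverse (real (Suc N)) < e" using reals_Archimedean by blast
    show "\<forall>\<^sub>F n in sequentially. \<forall>x\<in>UNIV. dist (P n x) (g x) < e"
      using eventually_ge_at_top[of N]
    proof eventually_elim
      case (elim n)
      have "1 / Suc n \<le> inverse (real (Suc N))"
        using elim by (simp add: field_simps)
      thus ?case using P(2)[of _ n] N by (metis dist_norm dist_commute le_less_trans less_trans less_le_trans)
    qed
  qed
  with P(1) show ?thesis by (rule that)
qed

lemma bohr_ap_continuous: assumes "bohr_ap g" shows "continuous_on UNIV g"
proof -
  obtain P where "\<And>k. trig_poly (P k)" "uniform_limit UNIV P g sequentially"
    using bohr_ap_sequence[OF assms] by blast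
  thus ?thesis
    by (intro uniform_limit_theorem[where f = P and F = sequentially]) (auto intro: trig_poly_continuous always_eventually)
qed

lemma bohr_ap_bounded: assumes "bohr_ap g" obtains B where "\<And>t. cmod (g t) \<le> B"
proof -
  obtain P where P: "trig_poly P" "\<And>t. cmod (g t - P t) < 1"
    using assms unfolding bohr_ap_def by (meson zero_less_one)
  obtain B where B: "\<And>t. cmod (P t) \<le> B" using trig_poly_bounded[OF P(1)] by blast
  have "cmod (g t) \<le> B + 1" for t
    using norm_triangle_ineq2[of "g t" "P t"] P(2)[of t] B[of t] by linarith
  thus ?thesis by (rule that)
qed

lemma bohr_ap_diff:
  assumes "bohr_ap g" "bohr_ap h"
  shows "bohr_ap (\<lambda>t. g t - h t)"
  unfolding bohr_ap_def
proof (intro allI impI)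
  fix \<epsilon> :: real assume "\<epsilon> > 0"
  then obtain P Q where P: "trig_poly P" "\<And>t. cmod (g t - P t) < \<epsilon> / 2"
      and Q: "trig_poly Q" "\<And>t. cmod (h t - Q t) < \<epsilon> / 2"
    using assms unfolding bohr_ap_def by (meson half_gt_zero)
  have "cmod (g t - h t - (P t - Q t)) < \<epsilon>" for t
    using norm_triangle_ineq4[of "g t - P t" "h t - Q t"] P(2)[of t] Q(2)[of t]
    by (simp add: algebra_simps)
  thus "\<exists>P. trig_poly P \<and> (\<forall>t. cmod (g t - h t - P t) < \<epsilon>)"
    using trig_poly_diff[OF P(1) Q(1)] by blast
qed

lemma bohr_ap_uniform_limit:
  assumes "\<And>k. bohr_ap (G k)" "uniform_limit UNIV G g sequentially"
  shows "bohr_ap g"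
  unfolding bohr_ap_def
proof (intro allI impI)
  fix \<epsilon> :: real assume e: "\<epsilon> > 0"
  then obtain k where k: "\<And>t. dist (G k t) (g t) < \<epsilon> / 2"
    using uniform_limitD[OF assms(2), of "\<epsilon> / 2"] by (auto simp: eventually_sequentially)
  obtain P where P: "trig_poly P" "\<And>t. cmod (G k t - P t) < \<epsilon> / 2"
    using assms(1) e unfolding bohr_ap_def by (meson half_gt_zero)
  have "cmod (g t - P t) < \<epsilon>" for t
    using norm_triangle_ineq[of "g t - G k t" "G k t - P t"] P(2)[of t] k[of t]
    by (simp add: dist_norm norm_minus_commute)
  thus "\<exists>P. trig_poly P \<and> (\<forall>t. cmod (g t - P t) < \<epsilon>)"
    using P(1) by blast
qed

lemma bohr_ap_shift:
  assumes "bohr_ap g"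
  shows "bohr_ap (\<lambda>t. g (t + c))"
proof -
  have "trig_poly (\<lambda>t. P (t + c))" if P: "trig_poly P" for P
  proof -
    obtain F a where F: "finite F" "P = (\<lambda>t. \<Sum>\<mu>\<in>F. a \<mu> * exp (\<i> * of_real \<mu> * of_real t))"
      using P by (auto simp: trig_poly_def)
    thus ?thesis unfolding trig_poly_def
      by (intro exI[of _ F] exI[of _ "\<lambda>\<mu>. a \<mu> * exp (\<i> * of_real \<mu> * of_real c)"])
        (simp add: algebra_simps exp_add)
  qed
  thus ?thesis using assms unfolding bohr_ap_def by meson
qed

text \<open>Sort \<open>t\<close> by the grid cells containing the points \<open>exp (i \<mu> t)\<close>; one representative \<open>k\<close> per
  non-empty cell suffices.\<close>

lemma trig_poly_translation_net:
  assumes P: "trig_poly P" and "\<epsilon> > 0"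
  obtains K where "finite K" "\<And>t. \<exists>k\<in>K. \<forall>x. cmod (P (x + t) - P (x + k)) < \<epsilon>"
proof -
  obtain F a where F: "finite F" and Pa: "P = (\<lambda>t. \<Sum>\<mu>\<in>F. a \<mu> * exp (\<i> * of_real \<mu> * of_real t))"
    using assms by (auto simp: trig_poly_def)
  define A where "A = (\<Sum>\<mu>\<in>F. cmod (a \<mu>))"
  have "A \<ge> 0" unfolding A_def by (rule sum_nonneg) simp
  \<comment> \<open>The grid must satisfy 2A/N < \<epsilon>; using \<open>A + 1\<close> in place of
    \<open>A\<close> also forces \<open>N > 0\<close> when all coefficients vanish.\<close>
  obtain N :: nat where N: "2 * (A + 1) / \<epsilon> < real N" using reals_Archimedean2 by blast
  have "2 * (A + 1) / \<epsilon> > 0" using \<open>A \<ge> 0\<close> \<open>\<epsilon> > 0\<close> by simp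
  hence "real N > 0" using N by linarith
  hence N': "A * (2 / N) < \<epsilon>" using N \<open>\<epsilon> > 0\<close> by (simp add: field_simps)
  \<comment> \<open>The cell of \<open>t\<close> records, for each frequency, the grid square of
    side 1/N containing exp (i \<mu> t). Restricting the function to \<open>F\<close> puts all cells
    into one finite product of integer ranges.\<close>
  define cell where "cell = (\<lambda>t. \<lambda>\<mu>\<in>F. (\<lfloor>N * cos (\<mu> * t)\<rfloor>, \<lfloor>N * sin (\<mu> * t)\<rfloor>))"
  have fl: "\<lfloor>N * c\<rfloor> \<in> {- int N..int N}" if "\<bar>c\<bar> \<le> 1" for c :: real
  proof -
    have "\<bar>real N * c\<bar> \<le> real N * 1" unfolding abs_mult using that by (intro mult_mono) auto
    thus ?thesis by (auto simp: le_floor_iff floor_le_iff)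
  qed
  have "range cell \<subseteq> (\<Pi>\<^sub>E \<mu>\<in>F. {- int N..int N} \<times> {- int N..int N})"
    unfolding cell_def using fl by (intro image_subsetI restrict_PiE_iff[THEN iffD2]) auto
  hence fin: "finite (range cell)" by (rule finite_subset) (use F in \<open>auto intro!: finite_PiE\<close>)
  define K where "K = inv cell ` range cell"
  have "\<exists>k\<in>K. \<forall>x. cmod (P (x + t) - P (x + k)) < \<epsilon>" for t
  proof
    let ?k = "inv cell (cell t)"
    show "?k \<in> K" by (auto simp: K_def)
    have eq: "cell ?k = cell t" by (rule f_inv_into_f) simp
    \<comment> \<open>Within one cell the real and the imaginary parts each differ by at most
      1/N.\<close>
    have "cmod (exp (\<i> * of_real \<mu> * of_real t) - exp (\<i> * of_real \<mu> * of_real ?k)) \<le> 2 / N"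
      if "\<mu> \<in> F" for \<mu>
    proof -
      have "\<lfloor>N * cos (\<mu> * t)\<rfloor> = \<lfloor>N * cos (\<mu> * ?k)\<rfloor>" "\<lfloor>N * sin (\<mu> * t)\<rfloor> = \<lfloor>N * sin (\<mu> * ?k)\<rfloor>"
        using fun_cong[OF eq, of \<mu>] that by (auto simp: cell_def)
      hence "\<bar>N * cos (\<mu> * t) - N * cos (\<mu> * ?k)\<bar> \<le> 1" "\<bar>N * sin (\<mu> * t) - N * sin (\<mu> * ?k)\<bar> \<le> 1"
        by linarith+
      hence "N * \<bar>cos (\<mu> * t) - cos (\<mu> * ?k)\<bar> \<le> 1" "N * \<bar>sin (\<mu> * t) - sin (\<mu> * ?k)\<bar> \<le> 1"
        by (simp_all add: abs_mult flip: right_diff_distrib)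
      hence "\<bar>cos (\<mu> * t) - cos (\<mu> * ?k)\<bar> \<le> 1 / N" "\<bar>sin (\<mu> * t) - sin (\<mu> * ?k)\<bar> \<le> 1 / N"
        using \<open>real N > 0\<close> by (simp_all add: field_simps)
      moreover have "exp (\<i> * of_real \<mu> * of_real t) - exp (\<i> * of_real \<mu> * of_real ?k)
          = Complex (cos (\<mu> * t) - cos (\<mu> * ?k)) (sin (\<mu> * t) - sin (\<mu> * ?k))"
        by (simp add: complex_eq_iff Re_exp Im_exp)
      ultimately show ?thesis
        using cmod_le[of "Complex (cos (\<mu> * t) - cos (\<mu> * ?k)) (sin (\<mu> * t) - sin (\<mu> * ?k))"] by simp
    qed note le = this
    show "\<forall>x. cmod (P (x + t) - P (x + ?k)) < \<epsilon>"
    proof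
      fix x
      \<comment> \<open>The dependence on \<open>x\<close> sits in a factor of modulus 1, hence the
        estimate is uniform in \<open>x\<close>.\<close>
      have "P (x + t) - P (x + ?k) = (\<Sum>\<mu>\<in>F. a \<mu> * exp (\<i> * of_real \<mu> * of_real x)
          * (exp (\<i> * of_real \<mu> * of_real t) - exp (\<i> * of_real \<mu> * of_real ?k)))"
        by (simp add: Pa algebra_simps sum_subtractf exp_add)
      also have "cmod \<dots> \<le> (\<Sum>\<mu>\<in>F. cmod (a \<mu>) * (2 / N))"
      proof (rule sum_norm_le)
        fix \<mu> assume "\<mu> \<in> F"
        have "cmod (a \<mu> * exp (\<i> * of_real \<mu> * of_real x)) = cmod (a \<mu>)"
          by (simp add: norm_mult norm_exp_eq_Re)
        thus "cmod (a \<mu> * exp (\<i> * of_real \<mu> * of_real x)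
            * (exp (\<i> * of_real \<mu> * of_real t) - exp (\<i> * of_real \<mu> * of_real ?k))) \<le> cmod (a \<mu>) * (2 / N)"
          unfolding norm_mult[of "a \<mu> * _"] using le[OF \<open>\<mu> \<in> F\<close>] by (simp only: mult_left_mono norm_ge_zero)
      qed
      also have "\<dots> = A * (2 / N)" unfolding A_def sum_distrib_right ..
      finally show "cmod (P (x + t) - P (x + ?k)) < \<epsilon>" using N' by linarith
    qed
  qed
  moreover have "finite K" unfolding K_def by (rule finite_imageI[OF fin])
  ultimately show ?thesis by (rule that[rotated])
qed

text \<open>For the inner product given by the mean, a function orthogonal to every character is
  orthogonal to their finite linear combinations.\<close>

lemma has_mean_mult_cnj_trig_poly:
  assumes "continuous_on UNIV g" "\<And>\<mu>. has_mean (\<lambda>t. g t * exp (- \<i> * of_real \<mu> * of_real t)) 0"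
    and "trig_poly P"
  shows "has_mean (\<lambda>t. g t * cnj (P t)) 0"
proof -
  obtain F a where F: "finite F" and Pa: "P = (\<lambda>t. \<Sum>\<mu>\<in>F. a \<mu> * exp (\<i> * of_real \<mu> * of_real t))"
    using assms by (auto simp: trig_poly_def)
  have "has_mean (\<lambda>t. \<Sum>\<mu>\<in>F. cnj (a \<mu>) * (g t * exp (- \<i> * of_real \<mu> * of_real t))) (\<Sum>\<mu>\<in>F. cnj (a \<mu>) * 0)"
    by (intro has_mean_sum F has_mean_cmult assms continuous_intros)
  moreover have "g t * cnj (P t) = (\<Sum>\<mu>\<in>F. cnj (a \<mu>) * (g t * exp (- \<i> * of_real \<mu> * of_real t)))" for t
    by (simp add: Pa sum_distrib_left exp_cnj algebra_simps)
  ultimately show ?thesis by simp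
qed

text \<open>The mean of \<open>\<bar>g\<bar>\<^sup>2\<close> vanishes, so does the mean of any finite sum of its translates; but
  finitely many translates suffice to keep such a sum away from zero if \<open>g\<close> is not identically zero.\<close>

theorem bohr_ap_eq_0:
  assumes g: "bohr_ap g" and mean: "\<And>\<mu>. has_mean (\<lambda>t. g t * exp (- \<i> * of_real \<mu> * of_real t)) 0"
  shows "g x = 0"
proof (rule ccontr)
  assume "g x \<noteq> 0"
  have cont: "continuous_on UNIV g" by (rule bohr_ap_continuous[OF g])
  obtain B where B: "\<And>t. cmod (g t) \<le> B" using bohr_ap_bounded[OF g] by blast
  hence "B \<ge> 0" by (meson norm_ge_zero order_trans)
  obtain P where P: "\<And>k. trig_poly (P k)" "uniform_limit UNIV P g sequentially"
    using bohr_ap_sequence[OF g] by blast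
  have Pc: "continuous_on UNIV (P k)" for k by (rule trig_poly_continuous[OF P(1)])
  have "uniform_limit UNIV (\<lambda>k t. cnj (P k t)) (\<lambda>t. cnj (g t)) sequentially"
    using P(2) unfolding uniform_limit_iff dist_norm complex_cnj_diff[symmetric] complex_mod_cnj .
  \<comment> \<open>Only the conjugated factor is approximated, so the mean of the squared modulus
    is a limit of means that are all zero.\<close>
  hence "uniform_limit UNIV (\<lambda>k t. g t * cnj (P k t)) (\<lambda>t. g t * cnj (g t)) sequentially"
    by (rule uniform_limit_mult_bounded) (rule B)
  then obtain l where "(\<lambda>k::nat. 0::complex) \<longlonglongrightarrow> l" "has_mean (\<lambda>t. g t * cnj (g t)) l"
    by (rule has_mean_uniform_limit)
      (auto intro!: continuous_intros cont Pc has_mean_mult_cnj_trig_poly mean P(1))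
  hence M: "has_mean (\<lambda>t. g t * cnj (g t)) 0" by (simp add: LIMSEQ_const_iff)
  \<comment> \<open>With a quarter of \<open>cmod (g x)\<close>, three errors below \<epsilon> still
    leave a remainder of at least \<epsilon>.\<close>
  define \<epsilon> where "\<epsilon> = cmod (g x) / 4"
  have \<epsilon>: "\<epsilon> > 0" using \<open>g x \<noteq> 0\<close> by (simp add: \<epsilon>_def)
  obtain Q where Q: "trig_poly Q" "\<And>t. cmod (g t - Q t) < \<epsilon>"
    using g \<epsilon> unfolding bohr_ap_def by meson
  obtain K where K: "finite K" "\<And>t. \<exists>k\<in>K. \<forall>y. cmod (Q (y + t) - Q (y + k)) < \<epsilon>"
    using trig_poly_translation_net[OF Q(1) \<epsilon>] by blast
  \<comment> \<open>The shifts \<open>x - k\<close> come from putting \<open>y = x - k\<close> in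
    the net property: for each \<open>t\<close> some \<open>k\<close> makes Q(t + (x - k)) close to
    Q(x), so one term of the sum is at least \<open>\<epsilon>\<^sup>2\<close>.\<close>
  define h where "h = (\<lambda>t. \<Sum>k\<in>K. (cmod (g (t + (x - k))))\<^sup>2)"
  have h: "of_real (h t) = (\<Sum>k\<in>K. g (t + (x - k)) * cnj (g (t + (x - k))))" for t
    unfolding h_def of_real_sum complex_norm_square ..
  have hc: "continuous_on UNIV (\<lambda>t. complex_of_real (h t))"
    unfolding h_def by (intro continuous_intros continuous_on_compose2[OF cont]) auto
  have "has_mean (\<lambda>t. \<Sum>k\<in>K. g (t + (x - k)) * cnj (g (t + (x - k)))) (\<Sum>k\<in>K. 0)"
  proof (intro has_mean_sum K)
    fix k
    show "continuous_on UNIV (\<lambda>t. g (t + (x - k)) * cnj (g (t + (x - k))))"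
      by (intro continuous_intros continuous_on_compose2[OF cont]) auto
    show "has_mean (\<lambda>t. g (t + (x - k)) * cnj (g (t + (x - k)))) 0"
    proof (rule has_mean_shift[where g = "\<lambda>t. g t * cnj (g t)", OF _ _ M])
      show "cmod (g t * cnj (g t)) \<le> B * B" for t
        unfolding norm_mult complex_mod_cnj by (intro mult_mono B) (auto simp: \<open>B \<ge> 0\<close>)
    qed (intro continuous_intros cont)
  qed
  hence hm: "has_mean (\<lambda>t. of_real (h t)) 0" by (simp add: h)
  have lo: "h t \<ge> \<epsilon>\<^sup>2" for t
  proof -
    obtain k where k: "k \<in> K" "\<And>y. cmod (Q (y + t) - Q (y + k)) < \<epsilon>" using K(2) by blast
    have "cmod (Q (t + (x - k)) - Q x) < \<epsilon>" using k(2)[of "x - k"] by (simp add: algebra_simps)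
    moreover have "g x = (g x - Q x) - (Q (t + (x - k)) - Q x)
        - (g (t + (x - k)) - Q (t + (x - k))) + g (t + (x - k))" by simp
    hence "cmod (g x) \<le> cmod (g x - Q x) + cmod (Q (t + (x - k)) - Q x)
        + cmod (g (t + (x - k)) - Q (t + (x - k))) + cmod (g (t + (x - k)))"
      by (smt (verit, ccfv_threshold) norm_triangle_ineq norm_triangle_ineq4)
    ultimately have "\<epsilon> \<le> cmod (g (t + (x - k)))"
      using Q(2)[of x] Q(2)[of "t + (x - k)"] by (simp add: \<epsilon>_def)
    hence "\<epsilon>\<^sup>2 \<le> (cmod (g (t + (x - k))))\<^sup>2" using \<epsilon> by (intro power_mono) auto
    also have "\<dots> \<le> h t" unfolding h_def by (rule member_le_sum) (use k K in auto)
    finally show ?thesis .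
  qed
  define C where "C = real (card K) * B\<^sup>2"
  have hi: "h t \<le> C" for t
    unfolding h_def C_def by (rule sum_bounded_above) (auto intro!: power_mono B)
  \<comment> \<open>\<open>has_mean_norm_le\<close> gives only upper bounds. The lower bound on
    \<open>h\<close> is therefore used through C - h, which lies between 0 and
    \<open>C - \<epsilon>\<^sup>2\<close> but has mean C.\<close>
  have "cmod (of_real C - 0) \<le> C - \<epsilon>\<^sup>2"
  proof (rule has_mean_norm_le)
    show "has_mean (\<lambda>t. of_real C - of_real (h t)) (of_real C - 0)"
      by (intro has_mean_diff has_mean_const hm hc continuous_intros)
    show "continuous_on UNIV (\<lambda>t. complex_of_real C - of_real (h t))"
      by (intro continuous_on_diff continuous_on_const hc)
    show "cmod (of_real C - of_real (h t)) \<le> C - \<epsilon>\<^sup>2" for t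
      using lo[of t] hi[of t] unfolding of_real_diff[symmetric] norm_of_real by linarith
  qed
  hence "\<bar>C\<bar> \<le> C - \<epsilon>\<^sup>2" by simp
  hence "\<epsilon>\<^sup>2 \<le> 0" by linarith
  thus False using \<epsilon> by simp
qed

section \<open>Simultaneous approximation\<close>

lemma norm_exp_i_diff_le: "cmod (exp (\<i> * of_real x) - exp (\<i> * of_real y)) \<le> \<bar>x - y\<bar>"
proof -
  have "exp (\<i> * of_real x) - exp (\<i> * of_real y) = exp (\<i> * of_real y) * (exp (\<i> * of_real (x - y)) - 1)"
    by (simp add: algebra_simps flip: exp_add)
  hence "cmod (exp (\<i> * of_real x) - exp (\<i> * of_real y)) = 2 * \<bar>sin ((x - y) / 2)\<bar>"
    by (simp only: norm_mult dist_exp_i_1) (simp add: norm_exp_eq_Re)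
  also have "\<dots> \<le> 2 * \<bar>(x - y) / 2\<bar>" using abs_sin_x_le_abs_x[of "(x - y) / 2"] by linarith
  finally show ?thesis by simp
qed

text \<open>Supplies the form of independence that \<open>Kronecker_thm_1\<close> expects: an
  integer relation is in particular a rational one.\<close>

lemma int_independent_if_rat_independent:
  assumes "rat_vs.independent G"
  shows "module.independent (\<lambda>r. (*) (real_of_int r)) G"
proof -
  interpret Z: Modules.module "(\<lambda>r. (*) (real_of_int r))"
    by (simp add: Modules.module.intro distrib_left mult.commute)
  show ?thesis
  proof
    assume "Z.dependent G"
    then obtain t u v where t: "finite t" "t \<subseteq> G" "(\<Sum>v\<in>t. real_of_int (u v) * v) = 0" "v \<in> t" "u v \<noteq> 0"
      by (auto simp: Z.dependent_explicit)
    have "rat_vs.dependent G"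
      unfolding rat_vs.dependent_explicit
      using t by (intro exI[of _ t] exI[of _ "\<lambda>v. of_int (u v)"]) (auto simp: rat_scale_def)
    with assms show False by simp
  qed
qed

text \<open>\<open>Kronecker_thm_1\<close> approximates modulo 1, so angles and the tolerance are
  first measured in full turns by dividing by 2 pi. The resulting time is 2 pi u, and the integers
  \<open>h i\<close> become full turns, invisible to the exponential.\<close>

lemma kronecker_finite:
  assumes "rat_vs.independent G" "finite G" "\<epsilon> > 0"
  obtains t where "\<And>g. g \<in> G \<Longrightarrow> cmod (exp (\<i> * of_real (g * t)) - exp (\<i> * of_real (\<theta> g))) < \<epsilon>"
proof -
  obtain e :: "nat \<Rightarrow> real" and n where e: "bij_betw e {..<n} G"
    using ex_bij_betw_nat_finite[OF assms(2)] by (metis atLeast0LessThan)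
  hence im: "e ` {..<n} = G" and inj: "inj_on e {..<n}" by (auto simp: bij_betw_def)
  have "\<epsilon> / (2 * pi) > 0" using assms(3) by simp
  then obtain u h where u: "\<And>i. i < n \<Longrightarrow> \<bar>u * e i - of_int (h i) - \<theta> (e i) / (2 * pi)\<bar> < \<epsilon> / (2 * pi)"
    using Kronecker_thm_1[OF _ inj, of "\<epsilon> / (2 * pi)" "\<lambda>i. \<theta> (e i) / (2 * pi)"]
      int_independent_if_rat_independent[OF assms(1)] im by metis
  have "cmod (exp (\<i> * of_real (g * (2 * pi * u))) - exp (\<i> * of_real (\<theta> g))) < \<epsilon>" if g: "g \<in> G" for g
  proof -
    obtain i where i: "i < n" "g = e i" using g im by auto
    have "exp (\<i> * of_real (g * (2 * pi * u)))
        = exp (\<i> * of_real (2 * pi * (u * g - of_int (h i))) + of_int (h i) * (of_real (2 * pi) * \<i>))"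
      by (simp add: algebra_simps)
    also have "\<dots> = exp (\<i> * of_real (2 * pi * (u * g - of_int (h i))))"
      by (subst exp_eq) (intro exI[of _ "h i"], simp)
    finally have "cmod (exp (\<i> * of_real (g * (2 * pi * u))) - exp (\<i> * of_real (\<theta> g)))
        \<le> \<bar>2 * pi * (u * g - of_int (h i)) - \<theta> g\<bar>"
      by (simp only: norm_exp_i_diff_le)
    also have "\<dots> = 2 * pi * \<bar>u * e i - of_int (h i) - \<theta> (e i) / (2 * pi)\<bar>"
    proof -
      have "2 * pi * (u * g - of_int (h i)) - \<theta> g = 2 * pi * (u * e i - of_int (h i) - \<theta> (e i) / (2 * pi))"
        unfolding i by (simp add: field_simps)
      thus ?thesis by (simp only: abs_mult) simp
    qed
    also have "\<dots> < 2 * pi * (\<epsilon> / (2 * pi))"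
      by (rule mult_strict_left_mono[OF u[OF i(1)]]) simp
    finally show ?thesis by simp
  qed
  thus ?thesis by (rule that)
qed

text \<open>The time \<open>t n\<close> serves the basis elements with index at most n, to precision
  1/(n+1); each fixed element is covered from its own index on.\<close>

lemma kronecker_sequence:
  assumes "rat_vs.independent G" "countable G"
  obtains t :: "nat \<Rightarrow> real"
  where "\<And>g. g \<in> G \<Longrightarrow> (\<lambda>n. exp (\<i> * of_real (g * t n))) \<longlonglongrightarrow> exp (\<i> * of_real (\<theta> g))"
proof -
  define H where "H n = {g \<in> G. to_nat_on G g \<le> n}" for n
  have "\<exists>t. \<forall>g\<in>H n. cmod (exp (\<i> * of_real (g * t)) - exp (\<i> * of_real (\<theta> g))) < 1 / Suc n" for n
  proof -
    have "finite (H n)"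
    proof (rule finite_imageD)
      show "finite (to_nat_on G ` H n)" by (rule finite_subset[of _ "{..n}"]) (auto simp: H_def)
      show "inj_on (to_nat_on G) (H n)"
        by (rule inj_on_subset[OF inj_on_to_nat_on[OF assms(2)]]) (auto simp: H_def)
    qed
    moreover have "rat_vs.independent (H n)"
      by (rule rat_vs.independent_mono[OF assms(1)]) (auto simp: H_def)
    ultimately show ?thesis
      using kronecker_finite[of "H n" "1 / Suc n" \<theta>] by (metis of_nat_0_less_iff zero_less_Suc zero_less_divide_1_iff)
  qed
  then obtain t where t: "\<And>n g. g \<in> H n \<Longrightarrow>
      cmod (exp (\<i> * of_real (g * t n)) - exp (\<i> * of_real (\<theta> g))) < 1 / Suc n"
    by metis
  have "(\<lambda>n. exp (\<i> * of_real (g * t n))) \<longlonglongrightarrow> exp (\<i> * of_real (\<theta> g))" if "g \<in> G" for g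
  proof (rule LIM_zero_cancel, rule Lim_null_comparison)
    show "\<forall>\<^sub>F n in sequentially. norm (exp (\<i> * of_real (g * t n)) - exp (\<i> * of_real (\<theta> g))) \<le> inverse (real (Suc n))"
      using eventually_ge_at_top[of "to_nat_on G g"]
    proof eventually_elim
      case (elim n)
      thus ?case using t[of g n] that by (auto simp: H_def inverse_eq_divide intro: less_imp_le)
    qed
  qed (rule LIMSEQ_inverse_real_of_nat)
  thus ?thesis by (rule that)
qed

lemma rat_linear_on_int_combination:
  assumes \<psi>: "rat_linear_on V \<psi>" and V: "rat_vs.subspace V" and F: "finite F" "F \<subseteq> V"
  shows "\<psi> (\<Sum>g\<in>F. of_int (c g) * g) = (\<Sum>g\<in>F. of_int (c g) * \<psi> g)"
proof -
  have sc: "of_int k * x = rat_scale (of_int k) x" for k and x :: real by (simp add: rat_scale_def)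
  have add: "\<psi> (x + y) = \<psi> x + \<psi> y" if "x \<in> V" "y \<in> V" for x y
    using \<psi> that by (auto simp: rat_linear_on_def)
  have scale: "\<psi> (rat_scale q x) = rat_scale q (\<psi> x)" if "x \<in> V" for q x
    using \<psi> that by (auto simp: rat_linear_on_def)
  have "\<psi> 0 = \<psi> (rat_scale 0 0)" by (simp add: rat_scale_def)
  also have "\<dots> = 0" by (subst scale) (use rat_vs.subspace_0[OF V] in \<open>auto simp: rat_scale_def\<close>)
  finally have zero: "\<psi> 0 = 0" .
  show ?thesis using F
  proof (induction F rule: finite_induct)
    case (insert x F)
    \<comment> \<open>\<psi> is known to be additive only on \<open>V\<close>, so every partial sum
      has to be placed in \<open>V\<close> first.\<close>
    have "(\<Sum>g\<in>F. of_int (c g) * g) \<in> V"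
      unfolding sc by (intro rat_vs.subspace_sum rat_vs.subspace_scale V) (use insert in auto)
    moreover have "of_int (c x) * x \<in> V"
      unfolding sc by (intro rat_vs.subspace_scale V) (use insert in auto)
    ultimately have "\<psi> (\<Sum>g\<in>insert x F. of_int (c g) * g) = \<psi> (of_int (c x) * x) + \<psi> (\<Sum>g\<in>F. of_int (c g) * g)"
      using insert by (simp add: add)
    also have "\<psi> (of_int (c x) * x) = of_int (c x) * \<psi> x"
      unfolding sc by (rule scale) (use insert in auto)
    finally show ?case using insert by simp
  qed (simp add: zero)
qed

lemma kronecker_integral_basis:
  assumes "countable \<Lambda>" "integral_basis \<Lambda> G" "rat_linear_on (rat_vs.span \<Lambda>) \<psi>"
  obtains t :: "nat \<Rightarrow> real"
  where "\<And>\<mu>. \<mu> \<in> \<Lambda> \<Longrightarrow> (\<lambda>n. exp (\<i> * of_real (\<mu> * t n))) \<longlonglongrightarrow> exp (\<i> * of_real (\<psi> \<mu>))"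
proof -
  have "\<forall>\<mu>\<in>\<Lambda>. \<exists>F (c :: real \<Rightarrow> int). finite F \<and> F \<subseteq> G \<and> \<mu> = (\<Sum>g\<in>F. of_int (c g) * g)"
    using assms(2) by (simp add: integral_basis_def)
  then obtain F and c :: "real \<Rightarrow> real \<Rightarrow> int" where F: "\<And>\<mu>. \<mu> \<in> \<Lambda> \<Longrightarrow> finite (F \<mu>)"
      "\<And>\<mu>. \<mu> \<in> \<Lambda> \<Longrightarrow> F \<mu> \<subseteq> G" "\<And>\<mu>. \<mu> \<in> \<Lambda> \<Longrightarrow> \<mu> = (\<Sum>g\<in>F \<mu>. of_int (c \<mu> g) * g)"
    by metis
  have ind: "rat_vs.independent G" and span: "rat_vs.span G = rat_vs.span \<Lambda>"
    using assms(2) by (auto simp: integral_basis_def)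
  \<comment> \<open>Keeping just the basis elements that occur in the chosen representations makes
    countability immediate from that of \<Lambda>.\<close>
  have "rat_vs.independent (\<Union>\<mu>\<in>\<Lambda>. F \<mu>)"
    by (rule rat_vs.independent_mono[OF ind]) (use F(2) in auto)
  moreover have "countable (\<Union>\<mu>\<in>\<Lambda>. F \<mu>)"
    by (intro countable_UN assms(1) countable_finite F(1))
  ultimately obtain t :: "nat \<Rightarrow> real" where
    t: "\<And>g. g \<in> (\<Union>\<mu>\<in>\<Lambda>. F \<mu>) \<Longrightarrow> (\<lambda>n. exp (\<i> * of_real (g * t n))) \<longlonglongrightarrow> exp (\<i> * of_real (\<psi> g))"
    using kronecker_sequence[of "\<Union>\<mu>\<in>\<Lambda>. F \<mu>" \<psi>] by blast
  \<comment> \<open>Integer powers are continuous and single-valued away from 0, so convergence at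
    the basis elements passes to \<mu>. The identity is applied both to g t(n) and to
    \<psi>(g).\<close>
  have expF: "exp (\<i> * of_real (\<Sum>g\<in>F \<mu>. of_int (c \<mu> g) * x g))
      = (\<Prod>g\<in>F \<mu>. exp (\<i> * of_real (x g)) powi c \<mu> g)" if "\<mu> \<in> \<Lambda>" for \<mu> and x :: "real \<Rightarrow> real"
    by (simp add: sum_distrib_left exp_sum F(1)[OF that] exp_power_int algebra_simps)
  have "(\<lambda>n. exp (\<i> * of_real (\<mu> * t n))) \<longlonglongrightarrow> exp (\<i> * of_real (\<psi> \<mu>))" if \<mu>: "\<mu> \<in> \<Lambda>" for \<mu>
  proof -
    have "\<mu> * t n = (\<Sum>g\<in>F \<mu>. of_int (c \<mu> g) * (g * t n))" for n
      using arg_cong[OF F(3)[OF \<mu>], of "\<lambda>x. x * t n"] by (simp add: sum_distrib_right mult.assoc)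
    moreover have "F \<mu> \<subseteq> rat_vs.span \<Lambda>"
      using F(2)[OF \<mu>] span rat_vs.span_superset by blast
    hence "\<psi> \<mu> = (\<Sum>g\<in>F \<mu>. of_int (c \<mu> g) * \<psi> g)"
      using rat_linear_on_int_combination[OF assms(3) rat_vs.subspace_span F(1)[OF \<mu>], of "c \<mu>"]
      by (metis F(3)[OF \<mu>])
    moreover have "(\<lambda>n. \<Prod>g\<in>F \<mu>. exp (\<i> * of_real (g * t n)) powi c \<mu> g)
        \<longlonglongrightarrow> (\<Prod>g\<in>F \<mu>. exp (\<i> * of_real (\<psi> g)) powi c \<mu> g)"
      by (intro tendsto_prod tendsto_power_int t) (use \<mu> in auto)
    ultimately show ?thesis by (simp only: expF[OF \<mu>])
  qed
  thus ?thesis by (rule that)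
qed

section \<open>Almost periodic functions on strips\<close>

definition strip :: "real \<Rightarrow> real \<Rightarrow> complex set" where
  "strip a b = {s. a \<le> Re s \<and> Re s \<le> b}"

text \<open>Equal frequencies are merged by adding their coefficients, so that the sum runs over a
  set of distinct frequencies.\<close>

lemma exponential_polynomialE:
  assumes "exponential_polynomial P"
  obtains F a where "finite F" "\<And>s. P s = (\<Sum>\<mu>\<in>F. a \<mu> * exp (of_real \<mu> * s))"
proof -
  obtain n a and l :: "nat \<Rightarrow> real" where P: "\<And>s. P s = (\<Sum>j<n. a j * exp (of_real (l j) * s))"
    using assms unfolding exponential_polynomial_def by blast
  have "P s = (\<Sum>\<mu>\<in>l ` {..<n}. (\<Sum>j | j \<in> {..<n} \<and> l j = \<mu>. a j) * exp (of_real \<mu> * s))" for s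
    unfolding P by (subst sum.image_gen[of _ _ l]) (auto simp: sum_distrib_right intro!: sum.cong)
  thus ?thesis by (rule that[rotated]) simp
qed

lemma exp_Complex: "exp (of_real \<mu> * Complex \<sigma> t) = of_real (exp (\<mu> * \<sigma>)) * exp (\<i> * of_real \<mu> * of_real t)"
  by (simp add: Complex_eq algebra_simps exp_add flip: exp_of_real)

lemma exp_line_continuous: "continuous_on UNIV (\<lambda>t. exp (of_real \<mu> * Complex \<sigma> t))"
  unfolding exp_Complex by (intro continuous_intros)

lemma norm_exp_line: "cmod (exp (of_real \<mu> * Complex \<sigma> t)) = exp (\<mu> * \<sigma>)"
  by (simp add: norm_exp_eq_Re)

lemma exponential_polynomial_line:
  assumes "exponential_polynomial P"
  shows "trig_poly (\<lambda>t. P (Complex \<sigma> t))"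
proof -
  obtain F a where F: "finite F" "\<And>s. P s = (\<Sum>\<mu>\<in>F. a \<mu> * exp (of_real \<mu> * s))"
    using exponential_polynomialE[OF assms] by blast
  thus ?thesis unfolding trig_poly_def
    by (intro exI[of _ F] exI[of _ "\<lambda>\<mu>. a \<mu> * of_real (exp (\<mu> * \<sigma>))"]) (simp add: F(2) exp_Complex mult.assoc)
qed

text \<open>The same \<open>m\<close> serves every \<sigma>: only the term \<nu> = \<mu> survives
  averaging, and its factor exp ((\<nu> - \<mu>) \<sigma>) is 1.\<close>

lemma exponential_polynomial_mean:
  assumes "exponential_polynomial P"
  obtains m where "\<And>\<sigma>. has_mean (\<lambda>t. P (Complex \<sigma> t) * exp (- of_real \<mu> * Complex \<sigma> t)) m"
proof -
  obtain F a where F: "finite F" "\<And>s. P s = (\<Sum>\<nu>\<in>F. a \<nu> * exp (of_real \<nu> * s))"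
    using exponential_polynomialE[OF assms] by blast
  define m where "m = (\<Sum>\<nu>\<in>F. a \<nu> * (if \<nu> - \<mu> = 0 then 1 else 0))"
  have "has_mean (\<lambda>t. P (Complex \<sigma> t) * exp (- of_real \<mu> * Complex \<sigma> t)) m" for \<sigma>
  proof -
    have "P (Complex \<sigma> t) * exp (- of_real \<mu> * Complex \<sigma> t)
        = (\<Sum>\<nu>\<in>F. (a \<nu> * of_real (exp ((\<nu> - \<mu>) * \<sigma>))) * exp (\<i> * of_real (\<nu> - \<mu>) * of_real t))" for t
    proof -
      have "exp (of_real \<nu> * Complex \<sigma> t) * exp (- of_real \<mu> * Complex \<sigma> t)
          = of_real (exp ((\<nu> - \<mu>) * \<sigma>)) * exp (\<i> * of_real (\<nu> - \<mu>) * of_real t)" for \<nu>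
        using exp_Complex[of "\<nu> - \<mu>" \<sigma> t] by (simp add: left_diff_distrib flip: exp_add)
      thus ?thesis by (simp add: F(2) sum_distrib_right mult.assoc)
    qed
    moreover have "has_mean (\<lambda>t. \<Sum>\<nu>\<in>F. (a \<nu> * of_real (exp ((\<nu> - \<mu>) * \<sigma>))) * exp (\<i> * of_real (\<nu> - \<mu>) * of_real t))
        (\<Sum>\<nu>\<in>F. (a \<nu> * of_real (exp ((\<nu> - \<mu>) * \<sigma>))) * (if \<nu> - \<mu> = 0 then 1 else 0))"
      by (intro has_mean_sum F has_mean_cmult has_mean_exp continuous_intros)
    moreover have "(\<Sum>\<nu>\<in>F. (a \<nu> * of_real (exp ((\<nu> - \<mu>) * \<sigma>))) * (if \<nu> - \<mu> = 0 then 1 else 0)) = m"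
      unfolding m_def by (rule sum.cong) auto
    ultimately show ?thesis by simp
  qed
  thus ?thesis by (rule that)
qed

lemma exponential_polynomial_holomorphic:
  assumes "exponential_polynomial P"
  shows "P holomorphic_on S"
proof -
  obtain F a where "finite F" and F: "\<And>s. P s = (\<Sum>\<mu>\<in>F. a \<mu> * exp (of_real \<mu> * s))"
    using exponential_polynomialE[OF assms] by blast
  have "P = (\<lambda>s. \<Sum>\<mu>\<in>F. a \<mu> * exp (of_real \<mu> * s))" using F by (rule ext)
  thus ?thesis by (auto intro!: holomorphic_intros)
qed

lemma uniform_limit_line:
  assumes "uniform_limit (strip a b) G g sequentially" "a \<le> \<sigma>" "\<sigma> \<le> b"
  shows "uniform_limit UNIV (\<lambda>k t. G k (Complex \<sigma> t)) (\<lambda>t. g (Complex \<sigma> t)) sequentially"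
proof (rule uniform_limitI)
  fix e :: real assume "e > 0"
  from uniform_limitD[OF assms(1) this]
  show "\<forall>\<^sub>F k in sequentially. \<forall>t\<in>UNIV. dist (G k (Complex \<sigma> t)) (g (Complex \<sigma> t)) < e"
    by eventually_elim (use assms(2,3) in \<open>auto simp: strip_def\<close>)
qed

section \<open>Restriction to lines, holomorphy and coefficients of a function in the class\<close>

context
  fixes \<alpha> \<beta> :: ereal and f :: "complex \<Rightarrow> complex"
  assumes ap: "f \<in> almost_periodic \<alpha> \<beta>"
begin

lemma almost_periodic_sequence:
  assumes "\<alpha> < ereal a" "a < b" "ereal b < \<beta>"
  obtains P where "\<And>k. exponential_polynomial (P k)" "uniform_limit (strip a b) P f sequentially"
proof -
  have "\<exists>P. exponential_polynomial P \<and> (\<forall>s\<in>strip a b. cmod (f s - P s) < 1 / Suc k)" for k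
    using ap assms unfolding almost_periodic_def strip_def by (simp del: of_nat_Suc)
  then obtain P where P: "\<And>k. exponential_polynomial (P k)"
    "\<And>k s. s \<in> strip a b \<Longrightarrow> cmod (f s - P k s) < 1 / Suc k"
    by metis
  have "uniform_limit (strip a b) P f sequentially"
  proof (rule uniform_limitI)
    fix e :: real assume "e > 0"
    then obtain N where N: "inverse (real (Suc N)) < e" using reals_Archimedean by blast
    show "\<forall>\<^sub>F n in sequentially. \<forall>s\<in>strip a b. dist (P n s) (f s) < e"
      using eventually_ge_at_top[of N]
    proof eventually_elim
      case (elim n)
      have "1 / Suc n \<le> inverse (real (Suc N))"
        using elim by (simp add: field_simps)
      thus ?case using P(2)[of _ n] N by (metis dist_norm dist_commute le_less_trans less_trans less_le_trans)
    qed
  qed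
  with P(1) show ?thesis by (rule that)
qed

lemma bohr_ap_line:
  assumes "\<alpha> < ereal \<sigma>" "ereal \<sigma> < \<beta>"
  shows "bohr_ap (\<lambda>t. f (Complex \<sigma> t))"
proof -
  \<comment> \<open>The definition of \<open>almost_periodic\<close> speaks of strips of positive
    width, so the line is made the left edge of one.\<close>
  obtain b where b: "ereal \<sigma> < ereal b" "ereal b < \<beta>" using ereal_dense2[OF assms(2)] by blast
  obtain P where P: "\<And>k. exponential_polynomial (P k)" "uniform_limit (strip \<sigma> b) P f sequentially"
    using almost_periodic_sequence[of \<sigma> b] assms b by auto
  show ?thesis
  proof (rule bohr_ap_uniform_limit)
    show "uniform_limit UNIV (\<lambda>k t. P k (Complex \<sigma> t)) (\<lambda>t. f (Complex \<sigma> t)) sequentially"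
      by (rule uniform_limit_line[OF P(2)]) (use b in auto)
    show "bohr_ap (\<lambda>t. P k (Complex \<sigma> t))" for k
      by (rule trig_poly_imp_bohr_ap[OF exponential_polynomial_line[OF P(1)]])
  qed
qed

lemma almost_periodic_holomorphic:
  assumes "\<alpha> < ereal a" "a < b" "ereal b < \<beta>"
  shows "f holomorphic_on {s. a < Re s \<and> Re s < b}"
proof -
  obtain P where P: "\<And>k. exponential_polynomial (P k)" "uniform_limit (strip a b) P f sequentially"
    using almost_periodic_sequence[OF assms] by blast
  have op: "open {s. a < Re s \<and> Re s < b}"
    by (intro open_Collect_conj open_halfspace_Re_gt open_halfspace_Re_lt)
  show ?thesis
  proof (rule holomorphic_uniform_sequence[OF op])
    show "P k holomorphic_on {s. a < Re s \<and> Re s < b}" for k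
      by (rule exponential_polynomial_holomorphic[OF P(1)])
    fix x assume "x \<in> {s. a < Re s \<and> Re s < b}"
    then obtain d where d: "d > 0" "cball x d \<subseteq> {s. a < Re s \<and> Re s < b}"
      using op open_contains_cball by blast
    moreover have "uniform_limit (cball x d) P f sequentially"
      by (rule uniform_limit_on_subset[OF P(2)]) (use d in \<open>auto simp: strip_def\<close>)
    ultimately show "\<exists>d>0. cball x d \<subseteq> {s. a < Re s \<and> Re s < b} \<and> uniform_limit (cball x d) P f sequentially"
      by blast
  qed
qed

text \<open>One approximating sequence works for all abscissae in [a, b]. Its means do not depend on
  \<sigma>, hence neither does their limit.\<close>

lemma common_mean:
  assumes "\<alpha> < ereal a" "a < b" "ereal b < \<beta>"
  obtains c where "\<And>\<sigma>. a \<le> \<sigma> \<Longrightarrow> \<sigma> \<le> b \<Longrightarrow>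
    has_mean (\<lambda>t. f (Complex \<sigma> t) * exp (- of_real \<mu> * Complex \<sigma> t)) c"
proof -
  obtain P where P: "\<And>k. exponential_polynomial (P k)" "uniform_limit (strip a b) P f sequentially"
    using almost_periodic_sequence[OF assms] by blast
  have "\<exists>m. \<forall>\<sigma>. has_mean (\<lambda>t. P k (Complex \<sigma> t) * exp (- of_real \<mu> * Complex \<sigma> t)) m" for k
    using exponential_polynomial_mean[OF P(1)] by metis
  then obtain m where m: "\<And>k \<sigma>. has_mean (\<lambda>t. P k (Complex \<sigma> t) * exp (- of_real \<mu> * Complex \<sigma> t)) (m k)"
    by metis
  have *: "\<exists>c. m \<longlonglongrightarrow> c \<and> has_mean (\<lambda>t. f (Complex \<sigma> t) * exp (- of_real \<mu> * Complex \<sigma> t)) c"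
    if \<sigma>: "a \<le> \<sigma>" "\<sigma> \<le> b" for \<sigma>
  proof -
    have "uniform_limit UNIV (\<lambda>k t. exp (- of_real \<mu> * Complex \<sigma> t) * P k (Complex \<sigma> t))
        (\<lambda>t. exp (- of_real \<mu> * Complex \<sigma> t) * f (Complex \<sigma> t)) sequentially"
      using norm_exp_line[of "-\<mu>" \<sigma>]
      by (intro uniform_limit_mult_bounded[OF uniform_limit_line[OF P(2) \<sigma>], of _ "exp (- \<mu> * \<sigma>)"]) simp
    hence "uniform_limit UNIV (\<lambda>k t. P k (Complex \<sigma> t) * exp (- of_real \<mu> * Complex \<sigma> t))
        (\<lambda>t. f (Complex \<sigma> t) * exp (- of_real \<mu> * Complex \<sigma> t)) sequentially"
      by (simp add: mult.commute)
    moreover have "continuous_on UNIV (\<lambda>t. P k (Complex \<sigma> t) * exp (- of_real \<mu> * Complex \<sigma> t))" for k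
      using exp_line_continuous[of "-\<mu>" \<sigma>]
        trig_poly_continuous[OF exponential_polynomial_line[OF P(1)[of k], of \<sigma>]]
      by (intro continuous_on_mult) simp_all
    ultimately show ?thesis using m[of _ \<sigma>] by (blast elim: has_mean_uniform_limit)
  qed
  obtain c where c: "m \<longlonglongrightarrow> c" using *[of a] assms by auto
  show ?thesis
    by (rule that[of c]) (use * c LIMSEQ_unique in blast)
qed

text \<open>Establishes the existence and uniqueness behind the \<open>THE\<close> in
  \<open>dirichlet_coeff\<close>. Any two abscissae are edges of a common reduced strip, where
  \<open>common_mean\<close> makes their means agree.\<close>

lemma has_mean_dirichlet_coeff:
  assumes "\<alpha> < ereal \<sigma>" "ereal \<sigma> < \<beta>"
  shows "has_mean (\<lambda>t. f (Complex \<sigma> t) * exp (- of_real \<mu> * Complex \<sigma> t)) (dirichlet_coeff \<alpha> \<beta> f \<mu>)"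
proof -
  let ?M = "\<lambda>\<sigma>. has_mean (\<lambda>t. f (Complex \<sigma> t) * exp (- of_real \<mu> * Complex \<sigma> t))"
  obtain b where b: "ereal \<sigma> < ereal b" "ereal b < \<beta>" using ereal_dense2[OF assms(2)] by blast
  obtain c where c: "?M \<sigma> c"
    using common_mean[of \<sigma> b \<mu>] assms b by (metis less_ereal.simps(1) less_imp_le order_refl)
  have all: "?M \<sigma>' c" if "\<alpha> < ereal \<sigma>'" "ereal \<sigma>' < \<beta>" for \<sigma>'
  proof (cases "\<sigma>' = \<sigma>")
    case False
    define a d where "a = min \<sigma> \<sigma>'" and "d = max \<sigma> \<sigma>'"
    have "\<alpha> < ereal a" "a < d" "ereal d < \<beta>"
      using that assms False by (auto simp: a_def d_def min_def max_def)
    then obtain c' where c': "\<And>\<tau>. a \<le> \<tau> \<Longrightarrow> \<tau> \<le> d \<Longrightarrow> ?M \<tau> c'"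
      using common_mean[of a d \<mu>] by blast
    have "?M \<sigma> c'" "?M \<sigma>' c'" by (intro c'; simp add: a_def d_def)+
    thus ?thesis using has_mean_unique c by blast
  qed (use c in simp)
  have "dirichlet_coeff \<alpha> \<beta> f \<mu> = (THE c. \<forall>\<sigma>. \<alpha> < ereal \<sigma> \<and> ereal \<sigma> < \<beta> \<longrightarrow> ?M \<sigma> c)"
    by (simp only: dirichlet_coeff_def has_mean_def avg_def)
  also have "\<dots> = c"
    by (rule the_equality) (use all assms has_mean_unique in blast)+
  finally show ?thesis using c by simp
qed

end

section \<open>Convergence of vertical translates\<close>

lemma translate_line: "Complex \<sigma> t + \<i> * of_real u = Complex \<sigma> (t + u)"
  by (simp add: complex_eq_iff)

text \<open>A vertical translation by u multiplies the term of frequency \<mu> by exp (i \<mu> u).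
  These finitely many factors converge, and they multiply functions that are bounded on the strip
  because Re s is.\<close>

lemma exponential_polynomial_translates_uniformly_Cauchy:
  assumes P: "\<And>s. P s = (\<Sum>\<mu>\<in>F. A \<mu> * exp (of_real \<mu> * s))" and "finite F"
    and conv: "\<And>\<mu>. \<mu> \<in> F \<Longrightarrow> \<exists>l. (\<lambda>n. exp (\<i> * of_real (\<mu> * u n))) \<longlonglongrightarrow> l"
  shows "uniformly_Cauchy_on (strip a b) (\<lambda>n s. P (s + \<i> * of_real (u n)))"
proof -
  obtain l where l: "\<And>\<mu>. \<mu> \<in> F \<Longrightarrow> (\<lambda>n. exp (\<i> * of_real (\<mu> * u n))) \<longlonglongrightarrow> l \<mu>"
    using conv by metis
  have summand: "uniform_limit (strip a b) (\<lambda>n s. (A \<mu> * exp (of_real \<mu> * s)) * exp (\<i> * of_real (\<mu> * u n)))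
      (\<lambda>s. (A \<mu> * exp (of_real \<mu> * s)) * l \<mu>) sequentially" if "\<mu> \<in> F" for \<mu>
  proof (rule uniform_limit_mult_bounded)
    show "uniform_limit (strip a b) (\<lambda>n s. exp (\<i> * of_real (\<mu> * u n))) (\<lambda>s. l \<mu>) sequentially"
    proof (rule uniform_limitI)
      fix e :: real assume "e > 0"
      from tendstoD[OF l[OF that] this]
      show "\<forall>\<^sub>F n in sequentially. \<forall>s\<in>strip a b. dist (exp (\<i> * of_real (\<mu> * u n))) (l \<mu>) < e"
        by eventually_elim simp
    qed
    fix s assume "s \<in> strip a b"
    hence "\<bar>Re s\<bar> \<le> \<bar>a\<bar> + \<bar>b\<bar>" by (simp add: strip_def) linarith
    hence "\<bar>\<mu>\<bar> * \<bar>Re s\<bar> \<le> \<bar>\<mu>\<bar> * (\<bar>a\<bar> + \<bar>b\<bar>)" by (rule mult_left_mono) simp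
    hence "\<mu> * Re s \<le> \<bar>\<mu>\<bar> * (\<bar>a\<bar> + \<bar>b\<bar>)"
      unfolding abs_mult[symmetric] by (rule order_trans[OF abs_ge_self])
    hence "exp (\<mu> * Re s) \<le> exp (\<bar>\<mu>\<bar> * (\<bar>a\<bar> + \<bar>b\<bar>))" by simp
    thus "cmod (A \<mu> * exp (of_real \<mu> * s)) \<le> cmod (A \<mu>) * exp (\<bar>\<mu>\<bar> * (\<bar>a\<bar> + \<bar>b\<bar>))"
      by (simp add: norm_mult norm_exp_eq_Re mult_left_mono)
  qed
  have "uniform_limit (strip a b) (\<lambda>n s. \<Sum>\<mu>\<in>F. (A \<mu> * exp (of_real \<mu> * s)) * exp (\<i> * of_real (\<mu> * u n)))
      (\<lambda>s. \<Sum>\<mu>\<in>F. (A \<mu> * exp (of_real \<mu> * s)) * l \<mu>) sequentially"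
    using \<open>finite F\<close> summand
  proof (induction F rule: finite_induct)
    case (insert x F)
    show ?case unfolding sum.insert[OF insert(1,2)]
      by (intro uniform_limit_add insert.prems insert.IH) auto
  qed (simp add: uniform_limit_const)
  moreover have "P (s + \<i> * of_real (u n))
      = (\<Sum>\<mu>\<in>F. (A \<mu> * exp (of_real \<mu> * s)) * exp (\<i> * of_real (\<mu> * u n)))" for n s
    by (simp add: P exp_add algebra_simps)
  ultimately show ?thesis
    by (intro uniformly_convergent_Cauchy) (auto simp: uniformly_convergent_on_def)
qed

text \<open>Vertical translation maps the strip into itself, so the error between P k and f is
  controlled at the translated points too, uniformly in the translation.\<close>

lemma uniformly_Cauchy_on_translates:
  assumes lim: "uniform_limit (strip a b) P f sequentially"
    and P: "\<And>k. uniformly_Cauchy_on (strip a b) (\<lambda>n s. P k (s + \<i> * of_real (u n)))"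
  shows "uniformly_Cauchy_on (strip a b) (\<lambda>n s. f (s + \<i> * of_real (u n)))"
proof (rule uniformly_Cauchy_onI)
  fix e :: real assume "e > 0"
  then obtain k where k: "\<And>s. s \<in> strip a b \<Longrightarrow> dist (P k s) (f s) < e / 3"
    using uniform_limitD[OF lim, of "e / 3"] by (auto simp: eventually_sequentially)
  obtain M where M: "\<And>s m n. s \<in> strip a b \<Longrightarrow> m \<ge> M \<Longrightarrow> n \<ge> M \<Longrightarrow>
      dist (P k (s + \<i> * of_real (u m))) (P k (s + \<i> * of_real (u n))) < e / 3"
    using P[of k] \<open>e > 0\<close> unfolding uniformly_Cauchy_on_def by (meson zero_less_divide_iff zero_less_numeral)
  have "dist (f (s + \<i> * of_real (u m))) (f (s + \<i> * of_real (u n))) < e"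
    if s: "s \<in> strip a b" and mn: "m \<ge> M" "n \<ge> M" for s m n
  proof -
    have tr: "s + \<i> * of_real v \<in> strip a b" for v using s by (simp add: strip_def)
    show ?thesis
      using dist_triangle[of "f (s + \<i> * of_real (u m))" "f (s + \<i> * of_real (u n))" "P k (s + \<i> * of_real (u m))"]
        dist_triangle[of "P k (s + \<i> * of_real (u m))" "f (s + \<i> * of_real (u n))" "P k (s + \<i> * of_real (u n))"]
        k[OF tr[of "u m"]] k[OF tr[of "u n"]] M[OF s mn]
      by (simp add: dist_commute)
  qed
  thus "\<exists>M. \<forall>s\<in>strip a b. \<forall>m\<ge>M. \<forall>n\<ge>M. dist (f (s + \<i> * of_real (u m))) (f (s + \<i> * of_real (u n))) < e"
    by blast
qed

text \<open>Bochner's normality property. All frequencies of all approximants form a countable set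
  on which the unimodular factors are bounded by 1, so one subsequence makes every factor
  converge.\<close>

lemma translates_convergent_subsequence:
  assumes "f \<in> almost_periodic \<alpha> \<beta>" "\<alpha> < ereal a" "a < b" "ereal b < \<beta>"
  obtains r :: "nat \<Rightarrow> nat" and h
  where "strict_mono r" "uniform_limit (strip a b) (\<lambda>n s. f (s + \<i> * of_real (t (r n)))) h sequentially"
proof -
  obtain P where P: "\<And>k. exponential_polynomial (P k)" "uniform_limit (strip a b) P f sequentially"
    using almost_periodic_sequence[OF assms] by blast
  have "\<exists>F A. finite F \<and> (\<forall>s. P k s = (\<Sum>\<mu>\<in>F. A \<mu> * exp (of_real \<mu> * s)))" for k
    using exponential_polynomialE[OF P(1)] by metis
  then obtain F A where F: "\<And>k. finite (F k)" "\<And>k s. P k s = (\<Sum>\<mu>\<in>F k. A k \<mu> * exp (of_real \<mu> * s))"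
    by metis
  have "countable (\<Union>k. F k)" using F(1) by (auto intro: countable_finite)
  then obtain r :: "nat \<Rightarrow> nat" where r: "strict_mono r"
    "\<And>\<mu>. \<mu> \<in> (\<Union>k. F k) \<Longrightarrow> \<exists>l. (\<lambda>n. exp (\<i> * of_real (\<mu> * t (r n)))) \<longlonglongrightarrow> l"
    by (rule function_convergent_subsequence[of _ "\<lambda>n \<mu>. exp (\<i> * of_real (\<mu> * t n))" 1])
      (auto simp: norm_exp_eq_Re)
  have "uniformly_Cauchy_on (strip a b) (\<lambda>n s. P k (s + \<i> * of_real (t (r n))))" for k
    by (rule exponential_polynomial_translates_uniformly_Cauchy[OF F(2) F(1)]) (use r(2) in blast)
  hence "uniformly_Cauchy_on (strip a b) (\<lambda>n s. f (s + \<i> * of_real (t (r n))))"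
    by (rule uniformly_Cauchy_on_translates[OF P(2)])
  then obtain h where "uniform_limit (strip a b) (\<lambda>n s. f (s + \<i> * of_real (t (r n)))) h sequentially"
    using Cauchy_uniformly_convergent unfolding uniformly_convergent_on_def by blast
  with r(1) show ?thesis by (rule that)
qed

lemma has_mean_translate:
  assumes "f \<in> almost_periodic \<alpha> \<beta>" "\<alpha> < ereal \<sigma>" "ereal \<sigma> < \<beta>"
  shows "has_mean (\<lambda>t. f (Complex \<sigma> (t + u)) * exp (- of_real \<mu> * Complex \<sigma> t))
    (exp (\<i> * of_real (\<mu> * u)) * dirichlet_coeff \<alpha> \<beta> f \<mu>)"
proof -
  let ?g = "\<lambda>t. f (Complex \<sigma> t) * exp (- of_real \<mu> * Complex \<sigma> t)"
  have bohr: "bohr_ap (\<lambda>t. f (Complex \<sigma> t))" by (rule bohr_ap_line[OF assms])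
  then obtain B where B: "\<And>t. cmod (f (Complex \<sigma> t)) \<le> B" using bohr_ap_bounded by blast
  have "has_mean (\<lambda>t. ?g (t + u)) (dirichlet_coeff \<alpha> \<beta> f \<mu>)"
  proof (rule has_mean_shift)
    show "continuous_on UNIV ?g"
      using exp_line_continuous[of "-\<mu>" \<sigma>] bohr_ap_continuous[OF bohr]
      by (intro continuous_on_mult) simp_all
    show "cmod (?g t) \<le> B * exp (- \<mu> * \<sigma>)" for t
      using norm_exp_line[of "-\<mu>" \<sigma> t] B by (simp add: norm_mult mult_right_mono)
  qed (rule has_mean_dirichlet_coeff[OF assms])
  \<comment> \<open>The shifted integrand carries exp (-\<mu> (s + i u)); the phase exp (i \<mu> u)
    restores exp (-\<mu> s).\<close>
  from has_mean_cmult[OF this, of "exp (\<i> * of_real (\<mu> * u))"] show ?thesis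
  proof (rule back_subst[where P = "\<lambda>g. has_mean g _"], intro ext)
    fix t
    have "exp (\<i> * of_real (\<mu> * u)) * exp (- of_real \<mu> * Complex \<sigma> (t + u)) = exp (- of_real \<mu> * Complex \<sigma> t)"
      by (simp add: Complex_eq algebra_simps flip: exp_add)
    thus "exp (\<i> * of_real (\<mu> * u)) * ?g (t + u) = f (Complex \<sigma> (t + u)) * exp (- of_real \<mu> * Complex \<sigma> t)"
      by (metis mult.left_commute)
  qed
qed

text \<open>The subsequential limit \<open>h\<close> is at first just a function on the strip. On
  each line it is a uniform limit of Bohr almost periodic functions, which gives it mean values and
  lets the uniqueness theorem be applied line by line.\<close>

lemma translates_tend_to:
  assumes f1: "f\<^sub>1 \<in> almost_periodic \<alpha> \<beta>" and f2: "f\<^sub>2 \<in> almost_periodic \<alpha> \<beta>"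
    and ab: "\<alpha> < ereal a" "a < b" "ereal b < \<beta>"
    and t: "\<And>\<mu>. (\<lambda>n. exp (\<i> * of_real (\<mu> * t n)) * dirichlet_coeff \<alpha> \<beta> f\<^sub>1 \<mu>) \<longlonglongrightarrow> dirichlet_coeff \<alpha> \<beta> f\<^sub>2 \<mu>"
  obtains u :: "nat \<Rightarrow> real"
  where "uniform_limit (strip a b) (\<lambda>n s. f\<^sub>1 (s + \<i> * of_real (u n))) f\<^sub>2 sequentially"
proof -
  obtain r :: "nat \<Rightarrow> nat" and h where r: "strict_mono r"
    and h: "uniform_limit (strip a b) (\<lambda>n s. f\<^sub>1 (s + \<i> * of_real (t (r n)))) h sequentially"
    using translates_convergent_subsequence[OF f1 ab] by blast
  have "h (Complex \<sigma> \<tau>) = f\<^sub>2 (Complex \<sigma> \<tau>)" if \<sigma>: "a \<le> \<sigma>" "\<sigma> \<le> b" for \<sigma> \<tau>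
  proof -
    have \<sigma>': "\<alpha> < ereal \<sigma>" "ereal \<sigma> < \<beta>"
      using ab \<sigma> by (meson ereal_less_eq(3) less_le_trans le_less_trans)+
    have line: "uniform_limit UNIV (\<lambda>n t'. f\<^sub>1 (Complex \<sigma> (t' + t (r n)))) (\<lambda>t'. h (Complex \<sigma> t')) sequentially"
      using uniform_limit_line[OF h \<sigma>] by (simp only: translate_line)
    have b1: "bohr_ap (\<lambda>t'. f\<^sub>1 (Complex \<sigma> (t' + v)))" for v
      using bohr_ap_shift[OF bohr_ap_line[OF f1 \<sigma>'], of v] .
    have bh: "bohr_ap (\<lambda>t'. h (Complex \<sigma> t'))" by (rule bohr_ap_uniform_limit[OF b1 line])
    have b2: "bohr_ap (\<lambda>t'. f\<^sub>2 (Complex \<sigma> t'))" by (rule bohr_ap_line[OF f2 \<sigma>'])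
    have ec: "continuous_on UNIV (\<lambda>t'. exp (- of_real \<mu> * Complex \<sigma> t'))" for \<mu>
      using exp_line_continuous[of "-\<mu>" \<sigma>] by simp
    have mh: "has_mean (\<lambda>t'. h (Complex \<sigma> t') * exp (- of_real \<mu> * Complex \<sigma> t')) (dirichlet_coeff \<alpha> \<beta> f\<^sub>2 \<mu>)" for \<mu>
    proof -
      have "uniform_limit UNIV (\<lambda>n t'. exp (- of_real \<mu> * Complex \<sigma> t') * f\<^sub>1 (Complex \<sigma> (t' + t (r n))))
          (\<lambda>t'. exp (- of_real \<mu> * Complex \<sigma> t') * h (Complex \<sigma> t')) sequentially"
        using norm_exp_line[of "-\<mu>" \<sigma>]
        by (intro uniform_limit_mult_bounded[OF line, of _ "exp (- \<mu> * \<sigma>)"]) simp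
      hence "uniform_limit UNIV (\<lambda>n t'. f\<^sub>1 (Complex \<sigma> (t' + t (r n))) * exp (- of_real \<mu> * Complex \<sigma> t'))
          (\<lambda>t'. h (Complex \<sigma> t') * exp (- of_real \<mu> * Complex \<sigma> t')) sequentially"
        by (simp add: mult.commute)
      then obtain l where
        "(\<lambda>n. exp (\<i> * of_real (\<mu> * t (r n))) * dirichlet_coeff \<alpha> \<beta> f\<^sub>1 \<mu>) \<longlonglongrightarrow> l"
        "has_mean (\<lambda>t'. h (Complex \<sigma> t') * exp (- of_real \<mu> * Complex \<sigma> t')) l"
        by (rule has_mean_uniform_limit)
          (rule continuous_on_mult[OF bohr_ap_continuous[OF b1] ec] has_mean_translate[OF f1 \<sigma>'])+
      moreover have "(\<lambda>n. exp (\<i> * of_real (\<mu> * t (r n))) * dirichlet_coeff \<alpha> \<beta> f\<^sub>1 \<mu>) \<longlonglongrightarrow> dirichlet_coeff \<alpha> \<beta> f\<^sub>2 \<mu>"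
        using LIMSEQ_subseq_LIMSEQ[OF t r] by (simp add: o_def)
      ultimately show ?thesis using LIMSEQ_unique by blast
    qed
    have "h (Complex \<sigma> \<tau>) - f\<^sub>2 (Complex \<sigma> \<tau>) = 0"
    proof (rule bohr_ap_eq_0[OF bohr_ap_diff[OF bh b2]])
      fix \<mu>
      have "has_mean (\<lambda>t'. h (Complex \<sigma> t') * exp (- of_real \<mu> * Complex \<sigma> t')
            - f\<^sub>2 (Complex \<sigma> t') * exp (- of_real \<mu> * Complex \<sigma> t'))
          (dirichlet_coeff \<alpha> \<beta> f\<^sub>2 \<mu> - dirichlet_coeff \<alpha> \<beta> f\<^sub>2 \<mu>)"
        by (intro has_mean_diff continuous_on_mult ec bohr_ap_continuous[OF bh] bohr_ap_continuous[OF b2]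
            mh has_mean_dirichlet_coeff[OF f2 \<sigma>'])
      \<comment> \<open>\<open>bohr_ap_eq_0\<close> tests against exp (-i \<mu> t), whereas
        coefficients use exp (-\<mu> s); the real factor exp (\<mu> \<sigma>) converts one into the
        other.\<close>
      from has_mean_cmult[OF this, of "of_real (exp (\<mu> * \<sigma>))"]
      have m0: "has_mean (\<lambda>t'. of_real (exp (\<mu> * \<sigma>)) * (h (Complex \<sigma> t') * exp (- of_real \<mu> * Complex \<sigma> t')
            - f\<^sub>2 (Complex \<sigma> t') * exp (- of_real \<mu> * Complex \<sigma> t'))) 0"
        by simp
      have "of_real (exp (\<mu> * \<sigma>)) * exp (- of_real \<mu> * Complex \<sigma> t') = exp (- \<i> * of_real \<mu> * of_real t')" for t'
        by (simp add: exp_of_real[symmetric] Complex_eq algebra_simps flip: exp_add)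
      hence "of_real (exp (\<mu> * \<sigma>)) * (h (Complex \<sigma> t') * exp (- of_real \<mu> * Complex \<sigma> t')
            - f\<^sub>2 (Complex \<sigma> t') * exp (- of_real \<mu> * Complex \<sigma> t'))
          = (h (Complex \<sigma> t') - f\<^sub>2 (Complex \<sigma> t')) * exp (- \<i> * of_real \<mu> * of_real t')" for t'
        by (metis left_diff_distrib mult.left_commute)
      with m0 show "has_mean (\<lambda>t'. (h (Complex \<sigma> t') - f\<^sub>2 (Complex \<sigma> t')) * exp (- \<i> * of_real \<mu> * of_real t')) 0"
        by (simp only:)
    qed
    thus ?thesis by simp
  qed
  hence "h s = f\<^sub>2 s" if "s \<in> strip a b" for s
    using that by (metis (no_types, lifting) complex_surj mem_Collect_eq strip_def)
  hence "uniform_limit (strip a b) (\<lambda>n s. f\<^sub>1 (s + \<i> * of_real (t (r n)))) f\<^sub>2 sequentially"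
    using h by (metis (no_types, lifting) uniform_limit_cong')
  thus ?thesis by (rule that)
qed

section \<open>Transfer of values by Hurwitz's theorem\<close>

lemma value_attained_by_limit_of_translates:
  assumes f1: "f\<^sub>1 holomorphic_on {s. a < Re s \<and> Re s < b}" and f2: "f\<^sub>2 holomorphic_on {s. a < Re s \<and> Re s < b}"
    and lim12: "uniform_limit (strip a b) (\<lambda>n s. f\<^sub>1 (s + \<i> * of_real (u n))) f\<^sub>2 sequentially"
    and lim21: "uniform_limit (strip a b) (\<lambda>n s. f\<^sub>2 (s + \<i> * of_real (v n))) f\<^sub>1 sequentially"
    and z: "a < Re z" "Re z < b"
  obtains s where "a < Re s" "Re s < b" "f\<^sub>1 s = f\<^sub>2 z"
proof -
  let ?S = "{s. a < Re s \<and> Re s < b}"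
  have "\<exists>s\<in>?S. f\<^sub>1 s = f\<^sub>2 z"
  proof (rule ccontr)
    assume no: "\<not> (\<exists>s\<in>?S. f\<^sub>1 s = f\<^sub>2 z)"
    have "?S = {s. a < Re s} \<inter> {s. Re s < b}" by auto
    hence conn: "connected ?S"
      by (metis convex_Int convex_connected convex_halfspace_Re_gt convex_halfspace_Re_lt)
    have op: "open ?S"
      by (intro open_Collect_conj open_halfspace_Re_gt open_halfspace_Re_lt)
    \<comment> \<open>This absurd inequality is Hurwitz's conclusion evaluated at \<open>z\<close>,
      a zero of the limit. The translates avoid the value \<open>f\<^sub>2 z\<close> because they
      stay in the strip, so only the assumption of nonconstancy can be false.\<close>
    have "f\<^sub>2 z - f\<^sub>2 z \<noteq> 0" if nonconst: "\<not> (\<lambda>s. f\<^sub>2 s - f\<^sub>2 z) constant_on ?S"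
    proof (rule Hurwitz_no_zeros[where \<F> = "\<lambda>n s. f\<^sub>1 (s + \<i> * of_real (u n)) - f\<^sub>2 z", OF op conn _ _ _ nonconst])
      show "(\<lambda>s. f\<^sub>1 (s + \<i> * of_real (u n)) - f\<^sub>2 z) holomorphic_on ?S" for n
        by (intro holomorphic_intros holomorphic_on_compose_gen[OF _ f1, unfolded o_def]) auto
      show "(\<lambda>s. f\<^sub>2 s - f\<^sub>2 z) holomorphic_on ?S" by (intro holomorphic_intros f2)
      show "uniform_limit K (\<lambda>n s. f\<^sub>1 (s + \<i> * of_real (u n)) - f\<^sub>2 z) (\<lambda>s. f\<^sub>2 s - f\<^sub>2 z) sequentially"
        if "K \<subseteq> ?S" for K
        by (intro uniform_limit_minus uniform_limit_const uniform_limit_on_subset[OF lim12])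
          (use that in \<open>auto simp: strip_def\<close>)
      show "f\<^sub>1 (s + \<i> * of_real (u n)) - f\<^sub>2 z \<noteq> 0" if "s \<in> ?S" for n s
        using no that by force
      show "z \<in> ?S" using z by simp
    qed
    hence "(\<lambda>s. f\<^sub>2 s - f\<^sub>2 z) constant_on ?S" by auto
    hence const: "f\<^sub>2 s = f\<^sub>2 z" if "s \<in> ?S" for s
      using that z by (auto simp: constant_on_def) (metis (no_types, lifting) diff_eq_diff_eq diff_self)
    \<comment> \<open>In the constant case the reverse limit turns \<open>f\<^sub>1 z\<close> into
      the limit of a constant sequence.\<close>
    have "(\<lambda>n. f\<^sub>2 (z + \<i> * of_real (v n))) \<longlonglongrightarrow> f\<^sub>1 z"
      by (rule tendsto_uniform_limitI[OF lim21]) (use z in \<open>auto simp: strip_def\<close>)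
    moreover have "f\<^sub>2 (z + \<i> * of_real (v n)) = f\<^sub>2 z" for n
      by (rule const) (use z in simp)
    ultimately have "f\<^sub>1 z = f\<^sub>2 z" by (simp add: LIMSEQ_const_iff)
    with no z show False by auto
  qed
  thus ?thesis using that by auto
qed

section \<open>Equivalent functions and the two inclusions\<close>

lemma ap_equivalent_sym:
  assumes "ap_equivalent \<alpha> \<beta> \<Lambda> f\<^sub>1 f\<^sub>2"
  shows "ap_equivalent \<alpha> \<beta> \<Lambda> f\<^sub>2 f\<^sub>1"
proof -
  obtain \<psi> where \<psi>: "rat_linear_on (rat_vs.span \<Lambda>) \<psi>"
    "\<And>\<mu>. \<mu> \<in> \<Lambda> \<Longrightarrow> dirichlet_coeff \<alpha> \<beta> f\<^sub>2 \<mu> = dirichlet_coeff \<alpha> \<beta> f\<^sub>1 \<mu> * exp (\<i> * of_real (\<psi> \<mu>))"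
    using assms by (auto simp: ap_equivalent_def)
  show ?thesis unfolding ap_equivalent_def
  proof (intro exI[of _ "\<lambda>x. - \<psi> x"] conjI ballI)
    show "rat_linear_on (rat_vs.span \<Lambda>) (\<lambda>x. - \<psi> x)"
      using \<psi>(1) by (auto simp: rat_linear_on_def rat_scale_def)
    show "dirichlet_coeff \<alpha> \<beta> f\<^sub>1 \<mu> = dirichlet_coeff \<alpha> \<beta> f\<^sub>2 \<mu> * exp (\<i> * of_real (- \<psi> \<mu>))" if "\<mu> \<in> \<Lambda>" for \<mu>
      by (simp add: \<psi>(2)[OF that] mult.assoc flip: exp_add)
  qed
qed

lemma equivalent_translates:
  assumes "countable \<Lambda>" "integral_basis \<Lambda> G" "f\<^sub>1 \<in> D_class \<alpha> \<beta> \<Lambda>" "f\<^sub>2 \<in> D_class \<alpha> \<beta> \<Lambda>"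
    and "ap_equivalent \<alpha> \<beta> \<Lambda> f\<^sub>1 f\<^sub>2"
    and ab: "\<alpha> < ereal a" "a < b" "ereal b < \<beta>"
  obtains u :: "nat \<Rightarrow> real"
  where "uniform_limit (strip a b) (\<lambda>n s. f\<^sub>1 (s + \<i> * of_real (u n))) f\<^sub>2 sequentially"
proof -
  obtain \<psi> where \<psi>: "rat_linear_on (rat_vs.span \<Lambda>) \<psi>"
    "\<And>\<mu>. \<mu> \<in> \<Lambda> \<Longrightarrow> dirichlet_coeff \<alpha> \<beta> f\<^sub>2 \<mu> = dirichlet_coeff \<alpha> \<beta> f\<^sub>1 \<mu> * exp (\<i> * of_real (\<psi> \<mu>))"
    using assms(5) by (auto simp: ap_equivalent_def)
  obtain t :: "nat \<Rightarrow> real"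
    where t: "\<And>\<mu>. \<mu> \<in> \<Lambda> \<Longrightarrow> (\<lambda>n. exp (\<i> * of_real (\<mu> * t n))) \<longlonglongrightarrow> exp (\<i> * of_real (\<psi> \<mu>))"
    using kronecker_integral_basis[OF assms(1,2) \<psi>(1)] by blast
  have "(\<lambda>n. exp (\<i> * of_real (\<mu> * t n)) * dirichlet_coeff \<alpha> \<beta> f\<^sub>1 \<mu>) \<longlonglongrightarrow> dirichlet_coeff \<alpha> \<beta> f\<^sub>2 \<mu>" for \<mu>
  proof (cases "\<mu> \<in> \<Lambda>")
    case True
    show ?thesis
      unfolding \<psi>(2)[OF True] mult.commute[of "dirichlet_coeff _ _ _ _"]
      by (intro tendsto_mult tendsto_const t True)
  next
    \<comment> \<open>Kronecker's theorem controls no frequency outside \<Lambda>, but there both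
      coefficients vanish by \<open>D_class\<close>. Thus the limit holds for every real \<mu>, as
      the uniqueness argument requires.\<close>
    case False
    hence "dirichlet_coeff \<alpha> \<beta> f\<^sub>1 \<mu> = 0" "dirichlet_coeff \<alpha> \<beta> f\<^sub>2 \<mu> = 0"
      using assms(3,4) by (auto simp: D_class_def)
    thus ?thesis by simp
  qed
  thus ?thesis
    using translates_tend_to[OF _ _ ab, of f\<^sub>1 f\<^sub>2 t] assms(3,4) that by (auto simp: D_class_def)
qed

text \<open>The hypotheses are symmetric in the two functions, so one inclusion suffices. Both
  directions of translation are already used here, on account of the constant case.\<close>

lemma equivalent_line_images_subset:
  assumes "countable \<Lambda>" "integral_basis \<Lambda> G" "f\<^sub>1 \<in> D_class \<alpha> \<beta> \<Lambda>" "f\<^sub>2 \<in> D_class \<alpha> \<beta> \<Lambda>"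
    and eq: "ap_equivalent \<alpha> \<beta> \<Lambda> f\<^sub>1 f\<^sub>2"
    and "open E" "\<forall>\<sigma>\<in>E. \<alpha> < ereal \<sigma> \<and> ereal \<sigma> < \<beta>"
  shows "(\<Union>\<sigma>\<in>E. line_image f\<^sub>2 \<sigma>) \<subseteq> (\<Union>\<sigma>\<in>E. line_image f\<^sub>1 \<sigma>)"
proof
  fix w assume "w \<in> (\<Union>\<sigma>\<in>E. line_image f\<^sub>2 \<sigma>)"
  then obtain \<sigma> \<tau> where \<sigma>: "\<sigma> \<in> E" "w = f\<^sub>2 (Complex \<sigma> \<tau>)" by (auto simp: line_image_def)
  \<comment> \<open>Hurwitz's theorem preserves the strip but not the abscissa of the point.
    Openness of \<open>E\<close> provides a strip around \<sigma> all of whose abscissae lie in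
    \<open>E\<close>, so the new point is still admissible.\<close>
  obtain e where e: "e > 0" "cball \<sigma> e \<subseteq> E"
    using \<open>open E\<close> \<sigma>(1) open_contains_cball by blast
  define a b where "a = \<sigma> - e" and "b = \<sigma> + e"
  have E: "x \<in> E" if "a \<le> x" "x \<le> b" for x
    using e(2) that by (auto simp: a_def b_def dist_real_def subset_iff)
  have ab: "\<alpha> < ereal a" "a < b" "ereal b < \<beta>"
    using assms(7) E[of a] E[of b] e(1) by (auto simp: a_def b_def)
  have f: "f\<^sub>1 \<in> almost_periodic \<alpha> \<beta>" "f\<^sub>2 \<in> almost_periodic \<alpha> \<beta>"
    using assms(3,4) by (auto simp: D_class_def)
  obtain u v :: "nat \<Rightarrow> real" where
    "uniform_limit (strip a b) (\<lambda>n s. f\<^sub>1 (s + \<i> * of_real (u n))) f\<^sub>2 sequentially"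
    "uniform_limit (strip a b) (\<lambda>n s. f\<^sub>2 (s + \<i> * of_real (v n))) f\<^sub>1 sequentially"
    using equivalent_translates[OF assms(1-5) ab]
      equivalent_translates[OF assms(1,2,4,3) ap_equivalent_sym[OF eq] ab] by metis
  then obtain s where s: "a < Re s" "Re s < b" "f\<^sub>1 s = f\<^sub>2 (Complex \<sigma> \<tau>)"
    using value_attained_by_limit_of_translates[OF almost_periodic_holomorphic[OF f(1) ab]
        almost_periodic_holomorphic[OF f(2) ab], of u v "Complex \<sigma> \<tau>"] e(1)
    by (auto simp: a_def b_def)
  have "w = f\<^sub>1 (Complex (Re s) (Im s))" using s(3) \<sigma>(2) by simp
  hence "w \<in> line_image f\<^sub>1 (Re s)" unfolding line_image_def by blast
  thus "w \<in> (\<Union>\<sigma>\<in>E. line_image f\<^sub>1 \<sigma>)" using E[of "Re s"] s by auto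
qed

theorem theorem1:
  fixes \<Lambda> E :: "real set" and \<alpha> \<beta> :: ereal and f\<^sub>1 f\<^sub>2 :: "complex \<Rightarrow> complex"
  assumes "countable \<Lambda>"
    and "\<exists>G. integral_basis \<Lambda> G"
    and "\<alpha> < \<beta>"
    and "f\<^sub>1 \<in> D_class \<alpha> \<beta> \<Lambda>"
    and "f\<^sub>2 \<in> D_class \<alpha> \<beta> \<Lambda>"
    and "ap_equivalent \<alpha> \<beta> \<Lambda> f\<^sub>1 f\<^sub>2"
    and "open E"
    and "\<forall>\<sigma>\<in>E. \<alpha> < ereal \<sigma> \<and> ereal \<sigma> < \<beta>"
  shows "(\<Union>\<sigma>\<in>E. line_image f\<^sub>1 \<sigma>) = (\<Union>\<sigma>\<in>E. line_image f\<^sub>2 \<sigma>)"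
proof -
  obtain G where G: "integral_basis \<Lambda> G" using assms(2) by blast
  show ?thesis
    using equivalent_line_images_subset[OF assms(1) G assms(4-8)]
      equivalent_line_images_subset[OF assms(1) G assms(5,4) ap_equivalent_sym[OF assms(6)] assms(7,8)]
    by (rule equalityI[rotated])
qed

end
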